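(* Let $H$ be a Hopf algebra over an algebraically closed field $\mathbb{K}$ of characteristic zero with a nonzero left integral $\int$, and let $\check H$ be the vector space $H$ with the convolution product $g*f=\int(fS(g_1))\,g_2$. For $h\in H$ let $\int^h\in H^*$ be the linear functional $\int^h(g):=\int(gS(h))$, $g\in H$. Then the map $h\mapsto\int^h$ is an isomorphism of algebras $\check H\to H^\square\subset H^*$.
   Context: $S$ is the antipode of $H$; Sweedler's notation $\Delta(g)=g_1\otimes g_2$ is used. A left integral is a nonzero linear functional $\int:H\to\mathbb{K}$ with $x_1\int(x_2)=\int(x)1_H$ for all $x\in H$; one such is fixed. $H^*$ is the space of all linear forms on $H$, an algebra with product $(\phi*\psi)(h)=\phi(h_1)\psi(h_2)$ and unit the counit $\varepsilon$. $H^\square$ is the rational submodule of $H^*$ regarded as a left module over itself, i.e. the sum of all left ideals of $H^*$ that are finite-dimensional over $\mathbb{K}$. *)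

theory Defs
  imports
    "HOL-Computational_Algebra.Polynomial"
    "HOL-Library.Poly_Mapping"
    "HOL-Library.Function_Algebras"
begin

section \<open>Free vector spaces\<close>

text \<open>The free \<open>'k\<close>-vector space on a type \<open>'x\<close> is the type \<open>'x \<Rightarrow>\<^sub>0 'k\<close> of finitely supported
  functions; the basis vector at \<open>x\<close> is \<open>Poly_Mapping.single x 1\<close>.\<close>

definition fscale :: "'k::field \<Rightarrow> ('x \<Rightarrow>\<^sub>0 'k) \<Rightarrow> ('x \<Rightarrow>\<^sub>0 'k)" where
  "fscale c p = Poly_Mapping.map ((*) c) p"

definition lin_ext ::
    "('k::field \<Rightarrow> 'v::ab_group_add \<Rightarrow> 'v) \<Rightarrow> ('x \<Rightarrow> 'v) \<Rightarrow> ('x \<Rightarrow>\<^sub>0 'k) \<Rightarrow> 'v" where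
  "lin_ext s f p = (\<Sum>x\<in>Poly_Mapping.keys p. s (Poly_Mapping.lookup p x) (f x))"

lemma lookup_fscale: "Poly_Mapping.lookup (fscale c p) x = c * Poly_Mapping.lookup p x"
  by (simp add: fscale_def Poly_Mapping.map.rep_eq when_def)

lemma vector_space_fscale: "vector_space (fscale :: 'k::field \<Rightarrow> ('x \<Rightarrow>\<^sub>0 'k) \<Rightarrow> _)"
  by unfold_locales (auto intro!: poly_mapping_eqI simp: lookup_fscale lookup_add algebra_simps)

section \<open>Tensor powers of a vector space\<close>

text \<open>For \<open>H\<close> the vector space \<open>'a\<close> with scalar multiplication \<open>scale\<close>, the spaces
  \<open>H \<otimes> H\<close> and \<open>H \<otimes> H \<otimes> H\<close> are the quotients of the free vector spaces on pairs and
  triples by the multilinearity relations. Their elements are cosets, that is, sets of formal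
  linear combinations of pairs and triples. \<open>lin_rels scale F\<close> expresses linearity in the slot
  marked by the variable of \<open>F\<close>.\<close>

definition lin_rels ::
    "('k::field \<Rightarrow> 'a::ab_group_add \<Rightarrow> 'a) \<Rightarrow> ('a \<Rightarrow> 'x) \<Rightarrow> ('x \<Rightarrow>\<^sub>0 'k) set" where
  "lin_rels scale F =
     {Poly_Mapping.single (F (x + y)) 1 - Poly_Mapping.single (F x) 1
        - Poly_Mapping.single (F y) 1 | x y. True}
   \<union> {Poly_Mapping.single (F (scale c x)) 1 - fscale c (Poly_Mapping.single (F x) 1) | c x. True}"

definition tensor2_rels ::
    "('k::field \<Rightarrow> 'a::ab_group_add \<Rightarrow> 'a) \<Rightarrow> (('a \<times> 'a) \<Rightarrow>\<^sub>0 'k) set" where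
  "tensor2_rels scale = module.span fscale
     ((\<Union>b. lin_rels scale (\<lambda>x. (x, b))) \<union> (\<Union>a. lin_rels scale (\<lambda>x. (a, x))))"

definition tensor3_rels ::
    "('k::field \<Rightarrow> 'a::ab_group_add \<Rightarrow> 'a) \<Rightarrow> (('a \<times> 'a \<times> 'a) \<Rightarrow>\<^sub>0 'k) set" where
  "tensor3_rels scale = module.span fscale
     ((\<Union>b c. lin_rels scale (\<lambda>x. (x, b, c))) \<union> (\<Union>a c. lin_rels scale (\<lambda>x. (a, x, c)))
      \<union> (\<Union>a b. lin_rels scale (\<lambda>x. (a, b, x))))"

definition tensor2_class ::
    "('k::field \<Rightarrow> 'a::ab_group_add \<Rightarrow> 'a) \<Rightarrow> (('a \<times> 'a) \<Rightarrow>\<^sub>0 'k) \<Rightarrow> (('a \<times> 'a) \<Rightarrow>\<^sub>0 'k) set" where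
  "tensor2_class scale p = {q. q - p \<in> tensor2_rels scale}"

definition tensor3_class ::
    "('k::field \<Rightarrow> 'a::ab_group_add \<Rightarrow> 'a) \<Rightarrow> (('a \<times> 'a \<times> 'a) \<Rightarrow>\<^sub>0 'k)
      \<Rightarrow> (('a \<times> 'a \<times> 'a) \<Rightarrow>\<^sub>0 'k) set" where
  "tensor3_class scale p = {q. q - p \<in> tensor3_rels scale}"

definition tensor2 ::
    "('k::field \<Rightarrow> 'a::ab_group_add \<Rightarrow> 'a) \<Rightarrow> (('a \<times> 'a) \<Rightarrow>\<^sub>0 'k) set set" where
  "tensor2 scale = range (tensor2_class scale)"

definition tensor_rep :: "('x \<Rightarrow>\<^sub>0 'k::field) set \<Rightarrow> ('x \<Rightarrow>\<^sub>0 'k)" where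
  "tensor_rep X = (SOME p. p \<in> X)"

text \<open>Sweedler notation: if \<open>\<Delta> h = h\<^sub>1 \<otimes> h\<^sub>2\<close> (summation understood), then
  \<open>sweedler s \<Delta> F h\<close> is \<open>F h\<^sub>1 h\<^sub>2\<close>, with values in the vector space with scalar
  multiplication \<open>s\<close>. The sum is evaluated on a chosen representative of \<open>\<Delta> h\<close>; by lemma
  \<open>lin_ext_tensor2_class\<close> below the choice is irrelevant for bilinear \<open>F\<close>.\<close>

definition sweedler ::
    "('k::field \<Rightarrow> 'v::ab_group_add \<Rightarrow> 'v) \<Rightarrow> ('a \<Rightarrow> (('a \<times> 'a) \<Rightarrow>\<^sub>0 'k) set)
      \<Rightarrow> ('a \<Rightarrow> 'a \<Rightarrow> 'v) \<Rightarrow> 'a \<Rightarrow> 'v" where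
  "sweedler s \<Delta> F h = lin_ext s (\<lambda>(a, b). F a b) (tensor_rep (\<Delta> h))"

lemma lin_ext_superset:
  assumes "vector_space s" "finite A" "Poly_Mapping.keys p \<subseteq> A"
  shows "lin_ext s f p = (\<Sum>x\<in>A. s (Poly_Mapping.lookup p x) (f x))"
proof -
  interpret vector_space s by fact
  show ?thesis unfolding lin_ext_def
    by (rule sum.mono_neutral_left) (use assms in \<open>auto simp: in_keys_iff\<close>)
qed

lemma linear_lin_ext:
  assumes "vector_space s"
  shows "Vector_Spaces.linear fscale s (lin_ext s f)"
proof -
  interpret V: vector_space s by fact
  interpret F: vector_space "fscale :: 'a \<Rightarrow> ('c \<Rightarrow>\<^sub>0 'a) \<Rightarrow> _" by (rule vector_space_fscale)
  show ?thesis
  proof (rule Vector_Spaces.linear_iff[THEN iffD2], intro conjI allI)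
    show "vector_space (fscale :: 'a \<Rightarrow> ('c \<Rightarrow>\<^sub>0 'a) \<Rightarrow> _)" by (rule vector_space_fscale)
    show "vector_space s" by fact
    fix p q :: "'c \<Rightarrow>\<^sub>0 'a" and c
    let ?A = "Poly_Mapping.keys p \<union> Poly_Mapping.keys q"
    have "Poly_Mapping.keys (p + q) \<subseteq> ?A" by (rule Poly_Mapping.keys_add)
    then show "lin_ext s f (p + q) = lin_ext s f p + lin_ext s f q"
      by (simp add: lin_ext_superset[OF assms, of ?A] lookup_add V.scale_left_distrib sum.distrib)
    have "Poly_Mapping.keys (fscale c p) \<subseteq> Poly_Mapping.keys p"
      by (auto simp: in_keys_iff lookup_fscale)
    then show "lin_ext s f (fscale c p) = s c (lin_ext s f p)"
      by (simp add: lin_ext_superset[OF assms, of "Poly_Mapping.keys p"] lookup_fscale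
          V.scale_sum_right)
  qed
qed

lemma lin_ext_tensor2_class:
  fixes scale :: "'k::field \<Rightarrow> 'a::ab_group_add \<Rightarrow> 'a" and s :: "'k \<Rightarrow> 'v::ab_group_add \<Rightarrow> 'v"
  assumes F1: "\<And>b. Vector_Spaces.linear scale s (\<lambda>a. F a b)"
    and F2: "\<And>a. Vector_Spaces.linear scale s (F a)"
    and pq: "q \<in> tensor2_class scale p"
  shows "lin_ext s (\<lambda>(a, b). F a b) q = lin_ext s (\<lambda>(a, b). F a b) p"
proof -
  interpret F0: Vector_Spaces.linear scale s "F a" for a by (rule F2)
  interpret F1: Vector_Spaces.linear scale s "\<lambda>a. F a b" for b by (rule F1)
  let ?L = "lin_ext s (\<lambda>(a, b). F a b)"
  have vs: "vector_space s" by unfold_locales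
  interpret E: vector_space "fscale :: 'k \<Rightarrow> (('a \<times> 'a) \<Rightarrow>\<^sub>0 'k) \<Rightarrow> _" by (rule vector_space_fscale)
  interpret L: Vector_Spaces.linear fscale s ?L by (rule linear_lin_ext[OF vs])
  have sing: "?L (Poly_Mapping.single (a, b) 1) = F a b" for a b
    by (simp add: lin_ext_def)
  have "?L r = 0" if "r \<in> tensor2_rels scale" for r
    using that unfolding tensor2_rels_def
  proof (rule E.span_induct)
    show "E.subspace {r. ?L r = 0}" by (rule L.subspace_kernel)
  qed (auto simp: lin_rels_def L.diff L.scale sing F0.add F0.scale F1.add F1.scale)
  then have "?L (q - p) = 0" using pq by (simp add: tensor2_class_def)
  then show ?thesis by (simp add: L.diff)
qed

section \<open>Hopf algebras\<close>

text \<open>In the axioms for \<open>\<Delta>\<close>, sums, multiples and products in \<open>H \<otimes> H\<close>, and the maps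
  \<open>\<Delta> \<otimes> id\<close> and \<open>id \<otimes> \<Delta>\<close>, are computed on representatives. The formal sums
  that arise depend on the representatives, but their cosets do not: the summands are
  multilinear modulo the relations.\<close>

locale hopf_algebra = vector_space scale
  for scale :: "'k::field \<Rightarrow> 'a::ring_1 \<Rightarrow> 'a" +
  fixes comult :: "'a \<Rightarrow> (('a \<times> 'a) \<Rightarrow>\<^sub>0 'k) set"
    and counit :: "'a \<Rightarrow> 'k"
    and antipode :: "'a \<Rightarrow> 'a"
  assumes scale_mult_left: "scale c a * b = scale c (a * b)"
    and scale_mult_right: "a * scale c b = scale c (a * b)"
    and comult_in_tensor2: "comult a \<in> tensor2 scale"
    and comult_add:
      "comult (a + b) = tensor2_class scale (tensor_rep (comult a) + tensor_rep (comult b))"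
    and comult_scale: "comult (scale c a) = tensor2_class scale (fscale c (tensor_rep (comult a)))"
    and comult_one: "comult 1 = tensor2_class scale (Poly_Mapping.single (1, 1) 1)"
    and comult_mult:
      "comult (a * b) = tensor2_class scale
         (sweedler fscale comult (\<lambda>a1 a2.
            sweedler fscale comult (\<lambda>b1 b2. Poly_Mapping.single (a1 * b1, a2 * b2) 1) b) a)"
    and coassoc:
      "tensor3_class scale
         (sweedler fscale comult (\<lambda>a1 a2.
            sweedler fscale comult (\<lambda>a11 a12. Poly_Mapping.single (a11, a12, a2) 1) a1) a)
       = tensor3_class scale
         (sweedler fscale comult (\<lambda>a1 a2.
            sweedler fscale comult (\<lambda>a21 a22. Poly_Mapping.single (a1, a21, a22) 1) a2) a)"
    and counit_linear: "Vector_Spaces.linear scale (*) counit"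
    and counit_one: "counit 1 = 1"
    and counit_mult: "counit (a * b) = counit a * counit b"
    and counit_left: "sweedler scale comult (\<lambda>a1 a2. scale (counit a1) a2) a = a"
    and counit_right: "sweedler scale comult (\<lambda>a1 a2. scale (counit a2) a1) a = a"
    and antipode_linear: "Vector_Spaces.linear scale scale antipode"
    and antipode_left:
      "sweedler scale comult (\<lambda>a1 a2. antipode a1 * a2) a = scale (counit a) 1"
    and antipode_right:
      "sweedler scale comult (\<lambda>a1 a2. a1 * antipode a2) a = scale (counit a) 1"

section \<open>The dual algebra and its rational part\<close>

definition dual :: "('k::field \<Rightarrow> 'a::ab_group_add \<Rightarrow> 'a) \<Rightarrow> ('a \<Rightarrow> 'k) set" where
  "dual scale = {\<phi>. Vector_Spaces.linear scale (*) \<phi>}"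

definition dual_scale :: "'k::field \<Rightarrow> ('a \<Rightarrow> 'k) \<Rightarrow> ('a \<Rightarrow> 'k)" where
  "dual_scale c \<phi> = (\<lambda>x. c * \<phi> x)"

lemma vector_space_dual_scale: "vector_space (dual_scale :: 'k::field \<Rightarrow> ('a \<Rightarrow> 'k) \<Rightarrow> _)"
  by unfold_locales (auto simp: dual_scale_def fun_eq_iff algebra_simps)

definition dual_mult ::
    "('a \<Rightarrow> (('a \<times> 'a) \<Rightarrow>\<^sub>0 'k::field) set) \<Rightarrow> ('a \<Rightarrow> 'k) \<Rightarrow> ('a \<Rightarrow> 'k) \<Rightarrow> ('a \<Rightarrow> 'k)" where
  "dual_mult \<Delta> \<phi> \<psi> = (\<lambda>h. sweedler (*) \<Delta> (\<lambda>h1 h2. \<phi> h1 * \<psi> h2) h)"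

definition dual_left_ideal ::
    "('k::field \<Rightarrow> 'a::ab_group_add \<Rightarrow> 'a) \<Rightarrow> ('a \<Rightarrow> (('a \<times> 'a) \<Rightarrow>\<^sub>0 'k) set)
      \<Rightarrow> ('a \<Rightarrow> 'k) set \<Rightarrow> bool" where
  "dual_left_ideal scale \<Delta> I \<longleftrightarrow>
     I \<subseteq> dual scale \<and> module.subspace dual_scale I
     \<and> (\<forall>\<phi>\<in>dual scale. \<forall>\<psi>\<in>I. dual_mult \<Delta> \<phi> \<psi> \<in> I)"

definition rational_part ::
    "('k::field \<Rightarrow> 'a::ab_group_add \<Rightarrow> 'a) \<Rightarrow> ('a \<Rightarrow> (('a \<times> 'a) \<Rightarrow>\<^sub>0 'k) set)
      \<Rightarrow> ('a \<Rightarrow> 'k) set" where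
  "rational_part scale \<Delta> = module.span dual_scale
     (\<Union>{I. dual_left_ideal scale \<Delta> I \<and> (\<exists>B. finite B \<and> I = module.span dual_scale B)})"

section \<open>Integrals\<close>

definition left_integral ::
    "('k::field \<Rightarrow> 'a::ring_1 \<Rightarrow> 'a) \<Rightarrow> ('a \<Rightarrow> (('a \<times> 'a) \<Rightarrow>\<^sub>0 'k) set) \<Rightarrow> ('a \<Rightarrow> 'k) \<Rightarrow> bool" where
  "left_integral scale \<Delta> \<Lambda> \<longleftrightarrow>
     \<Lambda> \<in> dual scale \<and> (\<exists>x. \<Lambda> x \<noteq> 0)
     \<and> (\<forall>x. sweedler scale \<Delta> (\<lambda>x1 x2. scale (\<Lambda> x2) x1) x = scale (\<Lambda> x) 1)"

text \<open>The product \<open>g * f = \<integral>(f S(g\<^sub>1)) g\<^sub>2\<close>, with \<open>\<Lambda>\<close> for the integral.\<close>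

definition integral_conv ::
    "('k::field \<Rightarrow> 'a::ring_1 \<Rightarrow> 'a) \<Rightarrow> ('a \<Rightarrow> (('a \<times> 'a) \<Rightarrow>\<^sub>0 'k) set) \<Rightarrow> ('a \<Rightarrow> 'a)
      \<Rightarrow> ('a \<Rightarrow> 'k) \<Rightarrow> 'a \<Rightarrow> 'a \<Rightarrow> 'a" where
  "integral_conv scale \<Delta> S \<Lambda> g f = sweedler scale \<Delta> (\<lambda>g1 g2. scale (\<Lambda> (f * S g1)) g2) g"

definition integral_functional :: "('a::ring_1 \<Rightarrow> 'a) \<Rightarrow> ('a \<Rightarrow> 'k::field) \<Rightarrow> 'a \<Rightarrow> ('a \<Rightarrow> 'k)" where
  "integral_functional S \<Lambda> h = (\<lambda>g. \<Lambda> (g * S h))"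

section \<open>Algebras that need not have a unit\<close>

definition nonunital_algebra ::
    "('k::field \<Rightarrow> 'v::ab_group_add \<Rightarrow> 'v) \<Rightarrow> 'v set \<Rightarrow> ('v \<Rightarrow> 'v \<Rightarrow> 'v) \<Rightarrow> bool" where
  "nonunital_algebra s A m \<longleftrightarrow>
     vector_space s \<and> module.subspace s A
     \<and> (\<forall>x\<in>A. \<forall>y\<in>A. m x y \<in> A)
     \<and> (\<forall>x\<in>A. \<forall>y\<in>A. \<forall>z\<in>A. m (m x y) z = m x (m y z))
     \<and> (\<forall>x\<in>A. \<forall>y\<in>A. \<forall>z\<in>A. m (x + y) z = m x z + m y z \<and> m x (y + z) = m x y + m x z)
     \<and> (\<forall>c. \<forall>x\<in>A. \<forall>y\<in>A. m (s c x) y = s c (m x y) \<and> m x (s c y) = s c (m x y))"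

definition nonunital_algebra_iso ::
    "('k::field \<Rightarrow> 'v::ab_group_add \<Rightarrow> 'v) \<Rightarrow> 'v set \<Rightarrow> ('v \<Rightarrow> 'v \<Rightarrow> 'v)
      \<Rightarrow> ('k \<Rightarrow> 'w::ab_group_add \<Rightarrow> 'w) \<Rightarrow> 'w set \<Rightarrow> ('w \<Rightarrow> 'w \<Rightarrow> 'w) \<Rightarrow> ('v \<Rightarrow> 'w) \<Rightarrow> bool" where
  "nonunital_algebra_iso s A m t B n f \<longleftrightarrow>
     nonunital_algebra s A m \<and> nonunital_algebra t B n \<and> bij_betw f A B
     \<and> (\<forall>x\<in>A. \<forall>y\<in>A. f (x + y) = f x + f y)
     \<and> (\<forall>c. \<forall>x\<in>A. f (s c x) = t c (f x))
     \<and> (\<forall>x\<in>A. \<forall>y\<in>A. f (m x y) = n (f x) (f y))"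

end

theory Submission
  imports Defs
begin

text \<open>For \<open>\<phi> \<in> H\<^sup>*\<close> put \<open>T\<^sub>\<phi>(x) = x\<^sub>1 \<phi>(x\<^sub>2)\<close>, so that \<open>(\<psi> * \<phi>)(x) = \<psi>(T\<^sub>\<phi>(x))\<close>, and \<open>\<phi>\<^sup>h(x) = \<phi>(x S(h))\<close>.
  Since \<open>S\<close> reverses \<open>\<Delta>\<close>, \<open>T(x)\<close> for \<open>\<phi>\<^sup>h\<close> is \<open>T\<^sub>\<phi>(x S(h\<^sub>1)) h\<^sub>2\<close>. For a left integral \<open>\<Lambda>\<close> this is
  \<open>\<Lambda>(x S(h\<^sub>1)) h\<^sub>2 = h * x\<close>, which gives multiplicativity, shows that \<open>\<Lambda>\<^sup>h\<close> is rational, and gives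
  injectivity: if \<open>\<Lambda>\<^sup>h = 0\<close> then \<open>0 = \<Lambda>(x S(h\<^sub>1 S(h\<^sub>2))) h\<^sub>3 = \<Lambda>(x) h\<close>.

  For surjectivity, the fundamental theorem of Hopf modules writes every rational form as a sum of
  \<open>\<mu>\<^sup>h\<close> with \<open>\<mu>\<close> left invariant, and left invariant forms are unique up to scalars. For the latter,
  if \<open>\<rho> = \<Lambda> \<circ> S\<close> is nonzero at \<open>g\<close>, then evaluating \<open>\<rho>(x\<^sub>1) \<mu>(x\<^sub>2 S(g))\<close> in two ways gives
  \<open>\<rho>(x) \<mu>(S(g)) = \<mu>(x S(g\<^sub>1 \<rho>(g\<^sub>2)))\<close>; subtracting from \<open>\<mu>\<close> the multiple of \<open>\<Lambda>\<close> that agrees with it at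
  \<open>S(g)\<close> leaves a form killed by a nonzero translation, hence \<open>0\<close>. Some left invariant form does not
  vanish on \<open>S(H)\<close>: otherwise every rational form would vanish at \<open>1\<close>, but the form
  \<open>x \<mapsto> \<Lambda>(h x)\<close> is rational with value \<open>\<Lambda>(h)\<close> at \<open>1\<close>.\<close>

section \<open>Sweedler calculus\<close>

lemma vector_space_mult: "vector_space ((*) :: 'k::field \<Rightarrow> 'k \<Rightarrow> 'k)"
  by unfold_locales (auto simp: algebra_simps)

lemma sum_apply_fun: "(\<Sum>j\<in>J. f j) x = (\<Sum>j\<in>J. f j x)"
  by (induction J rule: infinite_finite_induct) auto

lemma sweedler_linear_image:
  assumes "Vector_Spaces.linear s t f"
  shows "f (sweedler s \<Delta> F h) = sweedler t \<Delta> (\<lambda>a b. f (F a b)) h"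
proof -
  interpret Vector_Spaces.linear s t f by fact
  show ?thesis
    unfolding sweedler_def lin_ext_def by (simp add: sum scale split_def)
qed

lemma sweedler_commute:
  assumes "vector_space s"
  shows "sweedler s \<Delta> (\<lambda>a b. sweedler s \<Delta> (\<lambda>c d. G a b c d) y) x
       = sweedler s \<Delta> (\<lambda>c d. sweedler s \<Delta> (\<lambda>a b. G a b c d) x) y"
proof -
  interpret vector_space s by fact
  show ?thesis
    unfolding sweedler_def lin_ext_def
    by (simp add: split_def scale_sum_right mult.commute) (rule sum.swap)
qed

text \<open>A trilinear map kills the relations of the triple tensor product. This turns the coset
  equation \<open>coassoc\<close> into one between iterated Sweedler sums.\<close>

lemma lin_ext_tensor3_class:
  fixes scale :: "'k::field \<Rightarrow> 'a::ab_group_add \<Rightarrow> 'a" and s :: "'k \<Rightarrow> 'v::ab_group_add \<Rightarrow> 'v"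
  assumes F1: "\<And>b c. Vector_Spaces.linear scale s (\<lambda>a. F a b c)"
    and F2: "\<And>a c. Vector_Spaces.linear scale s (\<lambda>b. F a b c)"
    and F3: "\<And>a b. Vector_Spaces.linear scale s (F a b)"
    and pq: "tensor3_class scale q = tensor3_class scale p"
  shows "lin_ext s (\<lambda>(a, b, c). F a b c) q = lin_ext s (\<lambda>(a, b, c). F a b c) p"
proof -
  interpret F1: Vector_Spaces.linear scale s "\<lambda>a. F a b c" for b c by (rule F1)
  interpret F2: Vector_Spaces.linear scale s "\<lambda>b. F a b c" for a c by (rule F2)
  interpret F3: Vector_Spaces.linear scale s "F a b" for a b by (rule F3)
  let ?L = "lin_ext s (\<lambda>(a, b, c). F a b c)"
  have vs: "vector_space s" by unfold_locales
  interpret E: vector_space "fscale :: 'k \<Rightarrow> (('a \<times> 'a \<times> 'a) \<Rightarrow>\<^sub>0 'k) \<Rightarrow> _"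
    by (rule vector_space_fscale)
  interpret L: Vector_Spaces.linear fscale s ?L by (rule linear_lin_ext[OF vs])
  have sing: "?L (Poly_Mapping.single (a, b, c) 1) = F a b c" for a b c
    by (simp add: lin_ext_def)
  have ker: "?L r = 0" if "r \<in> tensor3_rels scale" for r
    using that unfolding tensor3_rels_def
  proof (rule E.span_induct)
    show "E.subspace {r. ?L r = 0}" by (rule L.subspace_kernel)
  qed (auto simp: lin_rels_def L.diff L.scale sing F1.add F1.scale F2.add F2.scale F3.add F3.scale)
  have "q \<in> tensor3_class scale q"
    by (simp add: tensor3_class_def tensor3_rels_def E.span_zero)
  then have "q - p \<in> tensor3_rels scale"
    using pq by (auto simp: tensor3_class_def)
  then show ?thesis using ker[of "q - p"] by (simp add: L.diff)
qed

lemma tensor_rep_in: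
  fixes scale :: "'k::field \<Rightarrow> 'a::ab_group_add \<Rightarrow> 'a"
  shows "tensor_rep (tensor2_class scale p) \<in> tensor2_class scale p"
proof -
  interpret E: vector_space "fscale :: 'k \<Rightarrow> (('a \<times> 'a) \<Rightarrow>\<^sub>0 'k) \<Rightarrow> _"
    by (rule vector_space_fscale)
  have "p \<in> tensor2_class scale p"
    by (simp add: tensor2_class_def tensor2_rels_def E.span_zero)
  then show ?thesis unfolding tensor_rep_def by (rule someI)
qed

lemma lin_ext_single [simp]:
  assumes "vector_space s"
  shows "lin_ext s f (Poly_Mapping.single x 1) = f x"
proof -
  interpret vector_space s by fact
  show ?thesis by (simp add: lin_ext_def)
qed

context hopf_algebra
begin

section \<open>Linearity and the Hopf axioms in Sweedler sums\<close>

abbreviation lin where "lin s f \<equiv> Vector_Spaces.linear scale s f"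

lemma linI:
  assumes "vector_space s" "\<And>x y. f (x + y) = f x + f y" "\<And>c x. f (scale c x) = s c (f x)"
  shows "lin s f"
  using assms vector_space_axioms by (auto simp: Vector_Spaces.linear_iff)

lemma lin_vs: "lin s f \<Longrightarrow> vector_space s"
  by (simp add: Vector_Spaces.linear_iff)

lemma lin_add: "lin s f \<Longrightarrow> f (x + y) = f x + f y"
  by (simp add: Vector_Spaces.linear_iff)

lemma lin_scale: "lin s f \<Longrightarrow> f (scale c x) = s c (f x)"
  by (simp add: Vector_Spaces.linear_iff)

lemma lin_ident: "lin scale (\<lambda>x. x)"
  by (rule linI) (auto simp: vector_space_axioms)

lemma lin_compose:
  assumes "lin s g" "lin scale f"
  shows "lin s (\<lambda>x. g (f x))"
  by (rule linI) (auto simp: lin_vs[OF assms(1)] lin_add[OF assms(1)] lin_add[OF assms(2)]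
      lin_scale[OF assms(1)] lin_scale[OF assms(2)])

lemma lin_scale_right:
  assumes "lin s f"
  shows "lin s (\<lambda>x. s c (f x))"
proof -
  interpret V: vector_space s by (rule lin_vs[OF assms])
  show ?thesis
    by (rule linI) (auto simp: V.vector_space_axioms V.scale_right_distrib mult.commute
        lin_add[OF assms] lin_scale[OF assms])
qed

lemma lin_scale_left: "lin (*) g \<Longrightarrow> lin scale (\<lambda>x. scale (g x) v)"
  by (rule linI) (auto simp: vector_space_axioms scale_left_distrib lin_add lin_scale)

lemma lin_times_left: "lin (*) g \<Longrightarrow> lin (*) (\<lambda>x. g x * v)"
  by (rule linI) (auto simp: vector_space_mult algebra_simps lin_add lin_scale)

lemma lin_mult_left: "lin scale f \<Longrightarrow> lin scale (\<lambda>x. c * f x)"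
  by (rule linI) (auto simp: vector_space_axioms algebra_simps lin_add lin_scale scale_mult_right)

lemma lin_mult_right: "lin scale f \<Longrightarrow> lin scale (\<lambda>x. f x * c)"
  by (rule linI) (auto simp: vector_space_axioms algebra_simps lin_add lin_scale scale_mult_left)

lemma lin_sweedler_param:
  assumes "\<And>a b. lin s (\<lambda>x. F x a b)"
  shows "lin s (\<lambda>x. sweedler s comult (F x) h)"
proof -
  interpret V: vector_space s using assms by (rule lin_vs)
  show ?thesis
    by (rule linI) (auto simp: V.vector_space_axioms sweedler_def lin_ext_def split_def
        lin_add[OF assms] lin_scale[OF assms] V.scale_right_distrib sum.distrib V.scale_sum_right
        mult.commute)
qed

lemma sweedler_eq_lin_ext:
  assumes "comult h = tensor2_class scale p"
    and "\<And>b. lin s (\<lambda>a. F a b)" and "\<And>a. lin s (F a)"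
  shows "sweedler s comult F h = lin_ext s (\<lambda>(a, b). F a b) p"
  unfolding sweedler_def
  by (rule lin_ext_tensor2_class) (use assms tensor_rep_in in auto)

text \<open>Representatives of \<open>comult (x + y)\<close> and of its summands are tied together
  only through cosets; bilinearity of \<open>F\<close> makes the value depend on the coset
  alone.\<close>

lemma lin_sweedler_arg:
  assumes F1: "\<And>b. lin s (\<lambda>a. F a b)" and F2: "\<And>a. lin s (F a)" and f: "lin scale f"
  shows "lin s (\<lambda>x. sweedler s comult F (f x))"
proof -
  have vs: "vector_space s" using F2 by (rule lin_vs)
  interpret L: Vector_Spaces.linear fscale s "lin_ext s (\<lambda>(a, b). F a b)"
    by (rule linear_lin_ext[OF vs])
  show ?thesis
  proof (rule linI[OF vs])
    fix x y c
    show "sweedler s comult F (f (x + y)) = sweedler s comult F (f x) + sweedler s comult F (f y)"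
      unfolding lin_add[OF f] by (subst sweedler_eq_lin_ext[OF comult_add F1 F2])
        (simp add: L.add sweedler_def)
    show "sweedler s comult F (f (scale c x)) = s c (sweedler s comult F (f x))"
      unfolding lin_scale[OF f] by (subst sweedler_eq_lin_ext[OF comult_scale F1 F2])
        (simp add: L.scale sweedler_def)
  qed
qed

lemma sweedler_one:
  assumes "\<And>b. lin s (\<lambda>a. F a b)" and "\<And>a. lin s (F a)"
  shows "sweedler s comult F 1 = F 1 1"
  using sweedler_eq_lin_ext[OF comult_one assms] lin_vs[OF assms(2)] by simp

lemma sweedler_mult:
  assumes F: "\<And>b. lin s (\<lambda>a. F a b)" "\<And>a. lin s (F a)"
  shows "sweedler s comult F (x * y) =
    sweedler s comult (\<lambda>x1 x2. sweedler s comult (\<lambda>y1 y2. F (x1 * y1) (x2 * y2)) y) x"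
proof -
  have vs: "vector_space s" using F(2) by (rule lin_vs)
  show ?thesis
    by (subst sweedler_eq_lin_ext[OF comult_mult F])
      (simp add: sweedler_linear_image[OF linear_lin_ext[OF vs]] vs)
qed

lemma sweedler_coassoc:
  assumes G: "\<And>b c. lin s (\<lambda>a. G a b c)" "\<And>a c. lin s (\<lambda>b. G a b c)" "\<And>a b. lin s (G a b)"
  shows "sweedler s comult (\<lambda>a b. sweedler s comult (\<lambda>a1 a2. G a1 a2 b) a) h
       = sweedler s comult (\<lambda>a b. sweedler s comult (\<lambda>b1 b2. G a b1 b2) b) h"
proof -
  have vs: "vector_space s" using G(3) by (rule lin_vs)
  from lin_ext_tensor3_class[OF G coassoc[of h]] show ?thesis
    by (simp add: sweedler_linear_image[OF linear_lin_ext[OF vs]] vs)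
qed

lemmas lin_intros = lin_ident lin_scale_right lin_scale_left lin_times_left lin_mult_left
  lin_mult_right lin_sweedler_param lin_sweedler_arg
  lin_compose[OF antipode_linear] lin_compose[OF counit_linear]

lemma sweedler_mult_left: "c * sweedler scale comult F h = sweedler scale comult (\<lambda>a b. c * F a b) h"
  by (rule sweedler_linear_image) (intro lin_intros)

lemma sweedler_mult_right: "sweedler scale comult F h * c = sweedler scale comult (\<lambda>a b. F a b * c) h"
  using sweedler_linear_image[of scale scale "\<lambda>x. x * c" comult F h] by (simp add: lin_intros)

lemma sweedler_counit_left:
  assumes "lin s f"
  shows "sweedler s comult (\<lambda>a b. s (counit a) (f b)) h = f h"
  using sweedler_linear_image[OF assms, of comult "\<lambda>a b. scale (counit a) b" h]
  by (simp add: counit_left lin_scale[OF assms])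

lemma sweedler_counit_right:
  assumes "lin s f"
  shows "sweedler s comult (\<lambda>a b. s (counit b) (f a)) h = f h"
  using sweedler_linear_image[OF assms, of comult "\<lambda>a b. scale (counit b) a" h]
  by (simp add: counit_right lin_scale[OF assms])

lemma sweedler_antipode_left:
  assumes "lin s f"
  shows "sweedler s comult (\<lambda>a b. f (antipode a * b)) h = s (counit h) (f 1)"
  using sweedler_linear_image[OF assms, of comult "\<lambda>a b. antipode a * b" h]
  by (simp add: antipode_left lin_scale[OF assms])

lemma sweedler_antipode_right:
  assumes "lin s f"
  shows "sweedler s comult (\<lambda>a b. f (a * antipode b)) h = s (counit h) (f 1)"
  using sweedler_linear_image[OF assms, of comult "\<lambda>a b. a * antipode b" h]
  by (simp add: antipode_right lin_scale[OF assms])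

subsection \<open>The antipode as an anti-homomorphism\<close>

lemma antipode_one: "antipode 1 = 1"
  using antipode_left[of 1] sweedler_one[of scale "\<lambda>a b. antipode a * b"]
  by (simp add: lin_intros counit_one)

text \<open>The expression \<open>S(x1 y1) x2 y2 S(y3) S(x3)\<close> is collapsed in two ways:
  cancelling on the right leaves \<open>S(x y)\<close>, cancelling on the left leaves
  \<open>S(y) S(x)\<close>.\<close>

lemma antipode_mult: "antipode (x * y) = antipode y * antipode x"
proof -
  let ?s = "sweedler scale comult"
  define G where "G x1 a b y1 c d =
    antipode (x1 * y1) * (a * (c * antipode d) * antipode b)" for x1 a b y1 c d
  have G_lin: "lin scale (\<lambda>x1. G x1 a b y1 c d)" "lin scale (\<lambda>a. G x1 a b y1 c d)"
    "lin scale (\<lambda>b. G x1 a b y1 c d)" "lin scale (\<lambda>y1. G x1 a b y1 c d)"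
    "lin scale (\<lambda>c. G x1 a b y1 c d)" "lin scale (\<lambda>d. G x1 a b y1 c d)"
    for x1 a b y1 c d
    unfolding G_def by (intro lin_intros)+
  have inner: "?s (\<lambda>a b. ?s (\<lambda>c d. G x1 a b y1 c d) y2) x2
      = scale (counit x2) (scale (counit y2) (antipode (x1 * y1)))" for x1 x2 y1 y2
  proof -
    have "?s (\<lambda>c d. G x1 a b y1 c d) y2
        = scale (counit y2) (antipode (x1 * y1) * (a * antipode b))" for a b
      unfolding G_def
      by (subst sweedler_antipode_right[where f = "\<lambda>z. antipode (x1 * y1) * (a * z * antipode b)"])
        (intro lin_intros, simp)
    then show ?thesis
      using sweedler_antipode_right[of scale "\<lambda>z. scale (counit y2) (antipode (x1 * y1) * z)" x2]
      by (simp add: lin_intros)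
  qed
  \<comment> \<open>As \<open>\<Delta>\<close> is multiplicative, \<open>S(x1 y1) a c\<close> sums
    to \<open>S(z1) z2\<close> with \<open>z = p * q\<close>.\<close>
  have inner': "?s (\<lambda>x1 a. ?s (\<lambda>y1 c. G x1 a b y1 c d) q) p
      = scale (counit p) (scale (counit q) (antipode d * antipode b))" for p q b d
    using sweedler_mult[of scale "\<lambda>u v. antipode u * v * (antipode d * antipode b)" p q]
      sweedler_antipode_left[of scale "\<lambda>z. z * (antipode d * antipode b)" "p * q"]
    by (simp add: lin_intros G_def mult.assoc counit_mult)
  have "antipode (x * y) = ?s (\<lambda>x1 x2. ?s (\<lambda>y1 y2. ?s (\<lambda>a b. ?s (\<lambda>c d. G x1 a b y1 c d) y2) x2) y) x"
    unfolding inner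
    by (subst sweedler_commute[OF vector_space_axioms],
        (subst sweedler_counit_right, (intro lin_intros)[1])+) (rule refl)
  also have "\<dots> = ?s (\<lambda>x1 x2. ?s (\<lambda>a b. ?s (\<lambda>y1 y2. ?s (\<lambda>c d. G x1 a b y1 c d) y2) y) x2) x"
    by (subst sweedler_commute[OF vector_space_axioms]) simp
  also have "\<dots> = ?s (\<lambda>x1 x2. ?s (\<lambda>a b. ?s (\<lambda>q d. ?s (\<lambda>y1 c. G x1 a b y1 c d) q) y) x2) x"
    by (subst sweedler_coassoc[where G = "\<lambda>y1 c d. G _ _ _ y1 c d"]) (rule G_lin refl)+
  also have "\<dots> = ?s (\<lambda>p b. ?s (\<lambda>x1 a. ?s (\<lambda>q d. ?s (\<lambda>y1 c. G x1 a b y1 c d) q) y) p) x"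
    by (rule sweedler_coassoc[symmetric])
      (intro lin_sweedler_param lin_sweedler_arg lin_ident G_lin)+
  also have "\<dots> = ?s (\<lambda>p b. ?s (\<lambda>q d. ?s (\<lambda>x1 a. ?s (\<lambda>y1 c. G x1 a b y1 c d) q) p) y) x"
    by (subst sweedler_commute[OF vector_space_axioms]) simp
  also have "\<dots> = antipode y * antipode x"
    unfolding inner'
    by (subst sweedler_commute[OF vector_space_axioms],
        (subst sweedler_counit_left, (intro lin_intros)[1])+) (rule refl)
  finally show ?thesis .
qed

text \<open>Both \<open>\<Delta>(S(h))\<close> and \<open>S(h2) \<otimes> S(h1)\<close> are
  convolution inverses of \<open>\<Delta>\<close>. The proof collapses
  \<open>\<Delta>(S(h1)) \<Delta>(h2) (S(h4) \<otimes> S(h3))\<close> from either end;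
  \<open>F\<close> is a test map, since tensors are cosets.\<close>

lemma sweedler_antipode:
  assumes F: "\<And>b. lin s (\<lambda>a. F a b)" "\<And>a. lin s (F a)"
  shows "sweedler s comult F (antipode h) = sweedler s comult (\<lambda>a b. F (antipode b) (antipode a)) h"
proof -
  let ?s = "sweedler s comult"
  have vs: "vector_space s" using F(2) by (rule lin_vs)
  note lin = lin_compose[OF F(1)] lin_compose[OF F(2)] lin_intros
  \<comment> \<open>Here \<open>p \<otimes> q\<close> stands for \<open>\<Delta>(S(a))\<close> and
    \<open>b, c, d, e\<close> for four consecutive components; the inner pair \<open>c, d\<close>
    cancels first, then the outer pair \<open>b, e\<close>.\<close>
  define K where "K p q b c d e = F (p * (b * antipode e)) (q * (c * antipode d))" for p q b c d e
  have K_lin: "lin s (\<lambda>c. K p q b c d e)" "lin s (\<lambda>d. K p q b c d e)"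
    "lin s (\<lambda>e. K p q b c d e)" for p q b c d e
    unfolding K_def by (intro lin)+
  define M where "M a b1 b2 c = ?s (\<lambda>p q. ?s (\<lambda>b3 b4. K p q b1 b2 b3 b4) c) (antipode a)"
    for a b1 b2 c
  have M_lin: "lin s (\<lambda>a. M a b1 b2 c)" "lin s (\<lambda>b1. M a b1 b2 c)"
    "lin s (\<lambda>b2. M a b1 b2 c)" "lin s (M a b1 b2)" for a b1 b2 c
    unfolding M_def K_def by (intro lin)+
  have inner: "?s (\<lambda>b1 b'. ?s (\<lambda>b2 b''. M a b1 b2 b'') b') b = s (counit b) (?s F (antipode a))" for a b
  proof -
    have "?s (\<lambda>b2 b''. M a b1 b2 b'') b'
        = ?s (\<lambda>p q. F (p * (b1 * antipode b')) q) (antipode a)" for b1 b'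
    proof -
      have "?s (\<lambda>b2 b''. M a b1 b2 b'') b'
        = ?s (\<lambda>p q. ?s (\<lambda>b2 b''. ?s (\<lambda>b3 b4. K p q b1 b2 b3 b4) b'') b') (antipode a)"
        unfolding M_def by (rule sweedler_commute[OF vs])
      also have "\<dots> = ?s (\<lambda>p q. ?s (\<lambda>b'' b4. ?s (\<lambda>b2 b3. K p q b1 b2 b3 b4) b'') b') (antipode a)"
        by (subst sweedler_coassoc[where G = "\<lambda>b2 b3 b4. K _ _ _ b2 b3 b4"]) (rule K_lin refl)+
      also have "\<dots> = ?s (\<lambda>p q. ?s (\<lambda>b'' b4. s (counit b'') (F (p * (b1 * antipode b4)) q)) b') (antipode a)"
        unfolding K_def
        by (subst sweedler_antipode_right[where f = "\<lambda>z. F _ (_ * z)"]) (intro lin, simp)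
      also have "\<dots> = ?s (\<lambda>p q. F (p * (b1 * antipode b')) q) (antipode a)"
        by (subst sweedler_counit_left) (intro lin, simp)
      finally show ?thesis .
    qed
    then have "?s (\<lambda>b1 b'. ?s (\<lambda>b2 b''. M a b1 b2 b'') b') b
       = ?s (\<lambda>p q. ?s (\<lambda>b1 b'. F (p * (b1 * antipode b')) q) b) (antipode a)"
      by (simp add: sweedler_commute[OF vs, of _ _ _ b])
    also have "\<dots> = ?s (\<lambda>p q. s (counit b) (F p q)) (antipode a)"
      by (subst sweedler_antipode_right[where f = "\<lambda>z. F (_ * z) _"]) (intro lin, simp)
    also have "\<dots> = s (counit b) (?s F (antipode a))"
      by (rule sweedler_linear_image[symmetric])
        (intro vector_space.linear_scale_self vs)
    finally show ?thesis .
  qed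
  have inner': "?s (\<lambda>a c. ?s (\<lambda>b1 b2. M a b1 b2 e) c) h1
      = s (counit h1) (?s (\<lambda>b3 b4. F (antipode b4) (antipode b3)) e)" for h1 e
  proof -
    let ?F = "\<lambda>u v. ?s (\<lambda>b3 b4. F (u * antipode b4) (v * antipode b3)) e"
    \<comment> \<open>Multiplicativity merges \<open>\<Delta>(S(a)) \<Delta>(c)\<close> into
      \<open>\<Delta>(S(a) c)\<close>, to which the antipode axiom applies.\<close>
    have "?s (\<lambda>b1 b2. M a b1 b2 e) c = ?s ?F (antipode a * c)" for a c
      unfolding M_def K_def
      by (subst sweedler_mult, (intro lin)+, subst sweedler_commute[OF vs]) (simp add: mult.assoc)
    then show ?thesis
      using sweedler_antipode_left[of s "\<lambda>z. ?s ?F z" h1] sweedler_one[of s ?F]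
      by (simp add: lin)
  qed
  have "?s F (antipode h) = ?s (\<lambda>a b. ?s (\<lambda>b1 b'. ?s (\<lambda>b2 b''. M a b1 b2 b'') b') b) h"
    unfolding inner by (rule sweedler_counit_right[symmetric]) (intro lin)
  also have "\<dots> = ?s (\<lambda>a b. ?s (\<lambda>c b''. ?s (\<lambda>b1 b2. M a b1 b2 b'') c) b) h"
    by (subst sweedler_coassoc[where G = "\<lambda>b1 b2 c. M _ b1 b2 c"]) (rule M_lin refl)+
  also have "\<dots> = ?s (\<lambda>h1 b''. ?s (\<lambda>a c. ?s (\<lambda>b1 b2. M a b1 b2 b'') c) h1) h"
    by (rule sweedler_coassoc[symmetric]) (intro lin lin_compose[OF M_lin(1)] lin_compose[OF M_lin(2)]
      lin_compose[OF M_lin(3)] lin_compose[OF M_lin(4)] M_lin)+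
  also have "\<dots> = ?s (\<lambda>a b. F (antipode b) (antipode a)) h"
    unfolding inner' by (rule sweedler_counit_left) (intro lin)
  finally show ?thesis .
qed

section \<open>The coaction on linear forms\<close>

text \<open>The operator \<open>T\<^sub>\<phi>\<close> of the overview, which is the left action of
  \<open>H\<^sup>*\<close> on \<open>H\<close>. When \<open>coact u x\<close> is a finite sum of
  terms \<open>v(x) c\<close>, the sum of the tensors \<open>v \<otimes> c\<close> is the coaction
  on \<open>u\<close>.\<close>

definition coact :: "('a \<Rightarrow> 'k) \<Rightarrow> 'a \<Rightarrow> 'a" where
  "coact \<phi> x = sweedler scale comult (\<lambda>a b. scale (\<phi> b) a) x"

lemma dual_iff: "\<phi> \<in> dual scale \<longleftrightarrow> lin (*) \<phi>"
  by (simp add: dual_def)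

lemma coact_linear: "lin (*) \<phi> \<Longrightarrow> lin scale (coact \<phi>)"
  unfolding coact_def by (intro lin_intros) (erule lin_compose, intro lin_intros)

lemma dual_mult_eq: "lin (*) \<phi> \<Longrightarrow> dual_mult comult \<phi> \<psi> x = \<phi> (coact \<psi> x)"
  unfolding coact_def dual_mult_def
  by (subst sweedler_linear_image, assumption) (simp add: lin_scale mult.commute)

lemma dual_mult_linear:
  "lin (*) \<phi> \<Longrightarrow> lin (*) \<psi> \<Longrightarrow> lin (*) (dual_mult comult \<phi> \<psi>)"
  using lin_compose[OF _ coact_linear, of "(*)" \<phi> \<psi>] by (simp add: dual_mult_eq[THEN ext])

text \<open>By coassociativity both sides are \<open>F x1 x2\<close> weighted by
  \<open>\<phi>(x3)\<close>.\<close>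

lemma sweedler_coact:
  assumes F: "\<And>b. lin s (\<lambda>a. F a b)" "\<And>a. lin s (F a)" and \<phi>: "lin (*) \<phi>"
  shows "sweedler s comult F (coact \<phi> x) = sweedler s comult (\<lambda>a b. F a (coact \<phi> b)) x"
proof -
  have vs: "vector_space s" using F(2) by (rule lin_vs)
  interpret V: vector_space s by fact
  note lin = lin_compose[OF F(1)] lin_compose[OF F(2)] lin_intros lin_compose[OF \<phi>]
  have "sweedler s comult F (coact \<phi> x)
      = sweedler s comult (\<lambda>a b. sweedler s comult F (scale (\<phi> b) a)) x"
    unfolding coact_def
    by (rule sweedler_linear_image) (intro lin)
  also have "\<dots> = sweedler s comult (\<lambda>a b. sweedler s comult (\<lambda>a1 a2. F a1 (scale (\<phi> b) a2)) a) x"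
    using lin_scale[OF lin_sweedler_arg[OF F lin_ident]]
      sweedler_linear_image[OF V.linear_scale_self, of _ comult F]
    by (simp add: lin_scale[OF F(2)])
  also have "\<dots> = sweedler s comult (\<lambda>a b. sweedler s comult (\<lambda>a1 a2. F a (scale (\<phi> a2) a1)) b) x"
    by (rule sweedler_coassoc) (intro lin)+
  also have "\<dots> = sweedler s comult (\<lambda>a b. F a (coact \<phi> b)) x"
    unfolding coact_def by (simp add: sweedler_linear_image[OF F(2)])
  finally show ?thesis .
qed

lemma coact_dual_mult:
  assumes "lin (*) \<phi>" "lin (*) \<psi>"
  shows "coact (dual_mult comult \<phi> \<psi>) x = coact \<phi> (coact \<psi> x)"
proof -
  have "coact \<phi> (coact \<psi> x) = sweedler scale comult (\<lambda>a b. scale (\<phi> (coact \<psi> b)) a) x"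
    by (subst coact_def, rule sweedler_coact)
      (intro lin_intros lin_compose[OF assms(1)] assms)+
  then show ?thesis
    by (simp add: coact_def[of "dual_mult _ _ _"] dual_mult_eq assms)
qed

lemma dual_mult_assoc:
  assumes "lin (*) \<phi>" "lin (*) \<psi>" "lin (*) \<chi>"
  shows "dual_mult comult (dual_mult comult \<phi> \<psi>) \<chi> = dual_mult comult \<phi> (dual_mult comult \<psi> \<chi>)"
  using assms by (intro ext) (simp add: dual_mult_eq dual_mult_linear coact_dual_mult)

lemma counit_coact: "lin (*) \<phi> \<Longrightarrow> counit (coact \<phi> x) = \<phi> x"
  using dual_mult_eq[OF counit_linear, of \<phi> x] sweedler_counit_left[of "(*)" \<phi> x]
  by (simp add: dual_mult_def)

text \<open>Reversal of \<open>\<Delta>\<close> by \<open>S\<close> turns the right side into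
  \<open>x1 S(y2) y3\<close> weighted by \<open>\<phi>(x2 S(y1))\<close>, where
  \<open>S(y2) y3\<close> cancels.\<close>

lemma coact_translate:
  assumes \<phi>: "lin (*) \<phi>"
  shows "coact (\<lambda>z. \<phi> (z * antipode y)) x
       = sweedler scale comult (\<lambda>y1 y2. coact \<phi> (x * antipode y1) * y2) y"
proof -
  let ?s = "sweedler scale comult"
  note lin = lin_intros lin_compose[OF \<phi>]
  define G where "G a b u v w = scale (\<phi> (b * antipode u)) (a * antipode v * w)" for a b u v w
  have G_lin: "lin scale (\<lambda>u. G a b u v w)" "lin scale (\<lambda>v. G a b u v w)"
    "lin scale (\<lambda>w. G a b u v w)" for a b u v w
    unfolding G_def by (intro lin)+
  have "coact \<phi> (x * antipode y1) * y2
      = ?s (\<lambda>a b. ?s (\<lambda>u v. G a b u v y2) y1) x" for y1 y2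
    unfolding coact_def
    by (subst sweedler_mult, (intro lin)+, subst sweedler_antipode, (intro lin)+)
      (simp add: sweedler_mult_right G_def scale_mult_left)
  then have "?s (\<lambda>y1 y2. coact \<phi> (x * antipode y1) * y2) y
      = ?s (\<lambda>a b. ?s (\<lambda>y1 y2. ?s (\<lambda>u v. G a b u v y2) y1) y) x"
    by (simp add: sweedler_commute[OF vector_space_axioms, of _ _ _ y])
  also have "\<dots> = ?s (\<lambda>a b. ?s (\<lambda>u w. ?s (\<lambda>v y2. G a b u v y2) w) y) x"
    by (subst sweedler_coassoc[where G = "\<lambda>u v w. G _ _ u v w"]) (rule G_lin refl)+
  also have "\<dots> = ?s (\<lambda>a b. ?s (\<lambda>u w. scale (counit w) (scale (\<phi> (b * antipode u)) a)) y) x"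
    unfolding G_def mult.assoc
    by (subst sweedler_antipode_left[where f = "\<lambda>z. scale (\<phi> (_ * antipode _)) (_ * z)"])
      (intro lin, simp)
  also have "\<dots> = ?s (\<lambda>a b. scale (\<phi> (b * antipode y)) a) x"
    by (subst sweedler_counit_right) (intro lin, rule refl)
  finally show ?thesis by (simp add: coact_def)
qed

text \<open>The right side unfolds to \<open>S(h1) h2 x1\<close> weighted by
  \<open>\<phi>(h3 x2)\<close>, where \<open>S(h1) h2\<close> cancels.\<close>

lemma coact_translate_left:
  assumes \<phi>: "lin (*) \<phi>"
  shows "coact (\<lambda>z. \<phi> (h * z)) x
       = sweedler scale comult (\<lambda>a b. antipode a * coact \<phi> (b * x)) h"
proof -
  let ?s = "sweedler scale comult"
  note lin = lin_intros lin_compose[OF \<phi>]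
  define G where "G u v a b c = scale (\<phi> (c * v)) (antipode a * b * u)" for u v a b c
  have G_lin: "lin scale (\<lambda>a. G u v a b c)" "lin scale (\<lambda>b. G u v a b c)"
    "lin scale (\<lambda>c. G u v a b c)" for u v a b c
    unfolding G_def by (intro lin)+
  have "antipode a * coact \<phi> (b * x)
      = ?s (\<lambda>u v. ?s (\<lambda>b1 b2. G u v a b1 b2) b) x" for a b
    unfolding coact_def
    by (subst sweedler_mult, (intro lin)+, subst sweedler_commute[OF vector_space_axioms])
      (simp add: sweedler_mult_left G_def scale_mult_right mult.assoc)
  then have "?s (\<lambda>a b. antipode a * coact \<phi> (b * x)) h
      = ?s (\<lambda>u v. ?s (\<lambda>a b. ?s (\<lambda>b1 b2. G u v a b1 b2) b) h) x"
    by (simp add: sweedler_commute[OF vector_space_axioms, of _ _ _ h])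
  also have "\<dots> = ?s (\<lambda>u v. ?s (\<lambda>a c. ?s (\<lambda>a1 a2. G u v a1 a2 c) a) h) x"
    by (subst sweedler_coassoc[where G = "\<lambda>a b c. G _ _ a b c"]) (rule G_lin refl)+
  also have "\<dots> = ?s (\<lambda>u v. ?s (\<lambda>a c. scale (counit a) (scale (\<phi> (c * v)) u)) h) x"
    unfolding G_def
    by (subst sweedler_antipode_left[where f = "\<lambda>z. scale (\<phi> (_ * _)) (z * _)"])
      (intro lin, simp)
  also have "\<dots> = ?s (\<lambda>u v. scale (\<phi> (h * v)) u) x"
    by (subst sweedler_counit_left) (intro lin, rule refl)
  finally show ?thesis by (simp add: coact_def)
qed

section \<open>Left invariant forms\<close>

definition left_inv :: "('a \<Rightarrow> 'k) \<Rightarrow> bool" where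
  "left_inv \<Lambda> \<longleftrightarrow> lin (*) \<Lambda> \<and> (\<forall>x. coact \<Lambda> x = scale (\<Lambda> x) 1)"

abbreviation translate :: "('a \<Rightarrow> 'k) \<Rightarrow> 'a \<Rightarrow> 'a \<Rightarrow> 'k" where
  "translate \<equiv> integral_functional antipode"

abbreviation conv :: "('a \<Rightarrow> 'k) \<Rightarrow> 'a \<Rightarrow> 'a \<Rightarrow> 'a" where
  "conv \<equiv> integral_conv scale comult antipode"

lemma left_integral_iff: "left_integral scale comult \<Lambda> \<longleftrightarrow> left_inv \<Lambda> \<and> (\<exists>x. \<Lambda> x \<noteq> 0)"
  unfolding left_integral_def left_inv_def coact_def dual_iff by blast

lemma translate_linear: "lin (*) \<phi> \<Longrightarrow> lin (*) (translate \<phi> y)"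
  unfolding integral_functional_def by (rule lin_compose, assumption) (intro lin_intros)

lemma translate_linear_arg: "lin (*) \<phi> \<Longrightarrow> lin (*) (\<lambda>y. translate \<phi> y x)"
  unfolding integral_functional_def by (rule lin_compose, assumption) (intro lin_intros)

text \<open>Left invariance makes \<open>coact \<Lambda> (f S(g1))\<close> the scalar
  \<open>\<Lambda>(f S(g1))\<close>, so \<open>coact_translate\<close> yields the convolution
  product.\<close>

lemma conv_eq_coact:
  assumes "left_inv \<Lambda>"
  shows "conv \<Lambda> g f = coact (translate \<Lambda> g) f"
  using assms coact_translate[of \<Lambda> g f]
  by (simp add: left_inv_def integral_conv_def integral_functional_def scale_mult_left)

lemma conv_eq_translate:
  "conv \<Lambda> g f = sweedler scale comult (\<lambda>a b. scale (translate \<Lambda> a f) b) g"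
  by (simp add: integral_conv_def integral_functional_def)

text \<open>Both sides equal \<open>\<Lambda>(x S(f1)) \<Lambda>(f2 S(g))\<close>:
  \<open>conv \<Lambda> f x\<close> is read by definition as \<open>\<Lambda>(x S(f1)) f2\<close>,
  and \<open>conv \<Lambda> g f\<close> through \<open>conv_eq_coact\<close> as
  \<open>f1 \<Lambda>(f2 S(g))\<close>.\<close>

lemma translate_conv:
  assumes "left_inv \<Lambda>"
  shows "translate \<Lambda> (conv \<Lambda> g f) = dual_mult comult (translate \<Lambda> g) (translate \<Lambda> f)"
proof
  fix x
  have l: "lin (*) \<Lambda>" using assms by (simp add: left_inv_def)
  have "dual_mult comult (translate \<Lambda> g) (translate \<Lambda> f) x = translate \<Lambda> g (conv \<Lambda> f x)"
    by (simp add: dual_mult_eq translate_linear l conv_eq_coact assms)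
  also have "\<dots> = sweedler (*) comult (\<lambda>a b. translate \<Lambda> g (scale (translate \<Lambda> a x) b)) f"
    unfolding conv_eq_translate
    by (rule sweedler_linear_image) (rule translate_linear[OF l])
  also have "\<dots> = sweedler (*) comult (\<lambda>a b. translate \<Lambda> (scale (translate \<Lambda> g b) a) x) f"
    by (simp add: lin_scale[OF translate_linear[OF l]] lin_scale[OF translate_linear_arg[OF l]]
        mult.commute)
  also have "\<dots> = translate \<Lambda> (conv \<Lambda> g f) x"
    unfolding conv_eq_coact[OF assms] coact_def
    by (rule sweedler_linear_image[symmetric]) (rule translate_linear_arg[OF l])
  finally show "translate \<Lambda> (conv \<Lambda> g f) x = dual_mult comult (translate \<Lambda> g) (translate \<Lambda> f) x"
    by simp
qed

section \<open>Injectivity of translation\<close>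

lemma comult_independent:
  obtains E s where "finite E" "independent E"
    "\<forall>F. (\<forall>b. lin scale (\<lambda>a. F a b)) \<longrightarrow> (\<forall>a. lin scale (F a))
      \<longrightarrow> sweedler scale comult F h = (\<Sum>e\<in>E. F (s e) e)"
proof -
  define B where "B = extend_basis {}"
  have B: "independent B" "span B = UNIV"
    unfolding B_def by (auto intro!: independent_extend_basis span_extend_basis independent_empty)
  define p where "p = tensor_rep (comult h)"
  define R where "R = representation B"
  \<comment> \<open>The second tensor factors are expanded in the basis \<open>B\<close>:
    \<open>E\<close> collects the finitely many basis vectors that occur, and \<open>s e\<close> is
    the total first factor standing next to \<open>e\<close>.\<close>
  define E where "E = (\<Union>q\<in>Poly_Mapping.keys p. {e. R (snd q) e \<noteq> 0})"
  define s where "s e = (\<Sum>q\<in>Poly_Mapping.keys p.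
    scale (Poly_Mapping.lookup p q * R (snd q) e) (fst q))" for e
  have fin: "finite E"
    unfolding E_def R_def by (auto intro: finite_representation)
  have "E \<subseteq> B"
    unfolding E_def R_def by (auto dest: representation_ne_zero)
  then have ind: "independent E" using B(1) independent_mono by blast
  have exp: "sweedler scale comult F h = (\<Sum>e\<in>E. F (s e) e)"
    if F1: "\<And>b. lin scale (\<lambda>a. F a b)" and F2: "\<And>a. lin scale (F a)" for F
  proof -
    have snd_q: "(\<Sum>e\<in>E. scale (R (snd q) e) e) = snd q" if "q \<in> Poly_Mapping.keys p" for q
    proof -
      have "(\<Sum>e\<in>E. scale (R (snd q) e) e) = (\<Sum>e | R (snd q) e \<noteq> 0. scale (R (snd q) e) e)"
        using fin that by (intro sum.mono_neutral_right) (auto simp: E_def)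
      then show ?thesis
        unfolding R_def using sum_nonzero_representation_eq[OF B(1), of "snd q"] B(2) by simp
    qed
    interpret F1: Vector_Spaces.linear scale scale "\<lambda>a. F a b" for b by (rule F1)
    interpret F2: Vector_Spaces.linear scale scale "F a" for a by (rule F2)
    have "sweedler scale comult F h
        = (\<Sum>q\<in>Poly_Mapping.keys p. scale (Poly_Mapping.lookup p q)
            (F (fst q) (\<Sum>e\<in>E. scale (R (snd q) e) e)))"
      unfolding sweedler_def lin_ext_def p_def[symmetric]
      by (intro sum.cong) (auto simp: snd_q split_def)
    also have "\<dots> = (\<Sum>e\<in>E. F (s e) e)"
      by (simp add: s_def F2.sum F2.scale F1.sum F1.scale scale_sum_right sum.swap[of _ E])
    finally show ?thesis .
  qed
  show thesis
  proof (rule that[OF fin ind], intro allI impI)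
    fix F
    assume "\<forall>b. lin scale (\<lambda>a. F a b)" "\<forall>a. lin scale (F a)"
    then show "sweedler scale comult F h = (\<Sum>e\<in>E. F (s e) e)"
      by (intro exp) (erule spec)+
  qed
qed

text \<open>Since \<open>conv \<Lambda> h z\<close> vanishes, independence of \<open>E\<close> gives
  \<open>\<Lambda>(z S(s e)) = 0\<close> for each \<open>e\<close> separately, so \<open>z\<close>
  may be chosen depending on the second tensor factor.\<close>

lemma translate_inj:
  assumes \<Lambda>: "left_inv \<Lambda>" and nz: "\<Lambda> x \<noteq> 0" and h: "\<And>z. translate \<Lambda> h z = 0"
  shows "h = 0"
proof -
  let ?s = "sweedler scale comult"
  have l: "lin (*) \<Lambda>" using \<Lambda> by (simp add: left_inv_def)
  note lin = lin_intros lin_compose[OF l]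
  obtain E s where E: "finite E" "independent E"
    and all_F: "\<forall>F. (\<forall>b. lin scale (\<lambda>a. F a b)) \<longrightarrow> (\<forall>a. lin scale (F a))
      \<longrightarrow> ?s F h = (\<Sum>e\<in>E. F (s e) e)"
    by (rule comult_independent[of h])
  have exp: "?s F h = (\<Sum>e\<in>E. F (s e) e)"
    if "\<And>b. lin scale (\<lambda>a. F a b)" "\<And>a. lin scale (F a)" for F
    by (rule all_F[THEN spec[of _ F], THEN mp, THEN mp]) (rule allI, rule that)+
  have s: "\<Lambda> (z * antipode (s e)) = 0" if "e \<in> E" for z e
  proof -
    have "(\<Sum>e\<in>E. scale (\<Lambda> (z * antipode (s e))) e) = conv \<Lambda> h z"
      unfolding integral_conv_def
      by (rule exp[of "\<lambda>a b. scale (\<Lambda> (z * antipode a)) b", symmetric]) (intro lin)+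
    also have "\<dots> = 0"
      using h by (simp add: conv_eq_coact[OF \<Lambda>] coact_def sweedler_def lin_ext_def split_def)
    finally show ?thesis
      by (rule independentD[OF E(2,1) order_refl _ that, of "\<lambda>e. \<Lambda> (z * antipode (s e))"])
  qed
  \<comment> \<open>This takes \<open>z = x S(S(b))\<close> with \<open>b\<close> the first part of
    \<open>\<Delta>(e)\<close>. Then \<open>S(S(b)) S(a) = S(a S(b))\<close>, and the antipode axiom
    cancels \<open>a S(b)\<close>.\<close>
  define G where "G a b c = scale (\<Lambda> (x * antipode (antipode b) * antipode a)) c" for a b c
  have G_lin: "lin scale (\<lambda>a. G a b c)" "lin scale (\<lambda>b. G a b c)" "lin scale (\<lambda>c. G a b c)" for a b c
    unfolding G_def by (intro lin)+
  have "0 = (\<Sum>e\<in>E. ?s (\<lambda>b c. G (s e) b c) e)"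
    by (rule sum.neutral[symmetric]) (simp add: G_def s sweedler_def lin_ext_def split_def)
  also have "\<dots> = ?s (\<lambda>a d. ?s (\<lambda>b c. G a b c) d) h"
    by (rule exp[of "\<lambda>a d. ?s (\<lambda>b c. G a b c) d", symmetric])
      (intro lin_sweedler_param lin_sweedler_arg lin_ident G_lin)+
  also have "\<dots> = ?s (\<lambda>d c. ?s (\<lambda>a b. G a b c) d) h"
    by (rule sweedler_coassoc[symmetric]) (rule G_lin)+
  also have "\<dots> = ?s (\<lambda>d c. scale (counit d) (scale (\<Lambda> x) c)) h"
    unfolding G_def mult.assoc antipode_mult[symmetric]
    by (subst sweedler_antipode_right[where f = "\<lambda>z. scale (\<Lambda> (_ * antipode z)) _"])
      (intro lin, simp add: antipode_one)
  also have "\<dots> = scale (\<Lambda> x) h"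
    by (rule sweedler_counit_left) (intro lin)
  finally show ?thesis using nz by simp
qed

section \<open>Comparison of two left invariant forms\<close>

lemma left_inv_right_inv:
  assumes "left_inv \<Lambda>"
  shows "sweedler scale comult (\<lambda>a b. scale (\<Lambda> (antipode a)) b) y = scale (\<Lambda> (antipode y)) 1"
proof -
  have l: "lin (*) \<Lambda>" using assms by (simp add: left_inv_def)
  \<comment> \<open>The element \<open>conv \<Lambda> y 1\<close> is computed twice: by definition,
    and as \<open>coact (translate \<Lambda> y) 1\<close> with
    \<open>\<Delta>(1) = 1 \<otimes> 1\<close>.\<close>
  have "sweedler scale comult (\<lambda>a b. scale (\<Lambda> (antipode a)) b) y = conv \<Lambda> y 1"
    by (simp add: integral_conv_def)
  also have "\<dots> = scale (translate \<Lambda> y 1) 1"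
    unfolding conv_eq_coact[OF assms] coact_def
    by (rule sweedler_one) (intro lin_intros lin_compose[OF translate_linear[OF l]])+
  finally show ?thesis by (simp add: integral_functional_def)
qed

text \<open>With \<open>\<rho> = \<Lambda> \<circ> S\<close>, both sides are the value at
  \<open>x\<close> of the product of \<open>\<rho>\<close> and \<open>translate \<mu> g\<close>: the
  left side by right invariance of \<open>\<rho>\<close>, the right side by left invariance of
  \<open>\<mu>\<close>.\<close>

lemma left_inv_swap:
  assumes \<Lambda>: "left_inv \<Lambda>" and \<mu>: "left_inv \<mu>"
  shows "\<Lambda> (antipode x) * \<mu> (antipode g) = \<mu> (x * antipode (coact (\<lambda>z. \<Lambda> (antipode z)) g))"
proof -
  let ?s = "sweedler (*) comult" and ?\<rho> = "\<lambda>z. \<Lambda> (antipode z)"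
  have l: "lin (*) \<Lambda>" and m: "lin (*) \<mu>" using \<Lambda> \<mu> by (auto simp: left_inv_def)
  have r: "lin (*) ?\<rho>" by (rule lin_compose[OF l]) (intro lin_intros)
  have t: "lin (*) (\<lambda>z. \<mu> (x * antipode z))" by (rule lin_compose[OF m]) (intro lin_intros)
  have "?\<rho> x * \<mu> (antipode g)
      = translate \<mu> g (sweedler scale comult (\<lambda>a b. scale (?\<rho> a) b) x)"
    by (simp add: left_inv_right_inv \<Lambda> lin_scale[OF translate_linear[OF m]])
      (simp add: integral_functional_def)
  also have "\<dots> = dual_mult comult ?\<rho> (translate \<mu> g) x"
    by (simp add: sweedler_linear_image[OF translate_linear[OF m]] dual_mult_def
        lin_scale[OF translate_linear[OF m]])
  also have "\<dots> = ?\<rho> (conv \<mu> g x)"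
    using r by (simp add: dual_mult_eq conv_eq_coact[OF \<mu>])
  also have "\<dots> = ?s (\<lambda>a b. \<mu> (x * antipode a) * ?\<rho> b) g"
    unfolding integral_conv_def sweedler_linear_image[OF r] by (simp add: lin_scale[OF r])
  also have "\<dots> = \<mu> (x * antipode (coact ?\<rho> g))"
    unfolding coact_def sweedler_linear_image[OF t] by (simp add: lin_scale[OF t] mult.commute)
  finally show ?thesis .
qed

lemma left_inv_unique_aux:
  assumes \<Lambda>: "left_inv \<Lambda>" and \<mu>: "left_inv \<mu>" and nz: "\<Lambda> (antipode g) \<noteq> 0"
  obtains c where "\<mu> = (\<lambda>x. c * \<Lambda> x)"
proof -
  \<comment> \<open>This constant makes \<open>\<nu>\<close> vanish at \<open>S(g)\<close>, so
    \<open>left_inv_swap\<close> shows that the translate of \<open>\<nu>\<close> by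
    \<open>?g\<close> is zero.\<close>
  define c where "c = \<mu> (antipode g) / \<Lambda> (antipode g)"
  define \<nu> where "\<nu> x = \<mu> x - c * \<Lambda> x" for x
  have l: "lin (*) \<Lambda>" and m: "lin (*) \<mu>" using \<Lambda> \<mu> by (auto simp: left_inv_def)
  have "lin (*) \<nu>"
    by (rule linI) (auto simp: \<nu>_def vector_space_mult lin_add[OF l] lin_add[OF m] lin_scale[OF l]
        lin_scale[OF m] algebra_simps)
  moreover have "coact \<nu> x = scale (\<nu> x) 1" for x
  proof -
    have "coact \<nu> x = coact \<mu> x - scale c (coact \<Lambda> x)"
      by (simp add: coact_def \<nu>_def sweedler_def lin_ext_def split_def scale_left_diff_distrib
          scale_right_diff_distrib sum_subtractf scale_sum_right mult.left_commute)
    then show ?thesis using \<Lambda> \<mu> by (simp add: left_inv_def \<nu>_def scale_left_diff_distrib)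
  qed
  ultimately have \<nu>: "left_inv \<nu>" by (simp add: left_inv_def)
  let ?g = "coact (\<lambda>z. \<Lambda> (antipode z)) g"
  have "\<nu> (antipode g) = 0" using nz by (simp add: \<nu>_def c_def)
  then have "translate \<nu> ?g x = 0" for x
    using left_inv_swap[OF \<Lambda> \<nu>, of x g] by (simp add: integral_functional_def)
  \<comment> \<open>Comparing \<open>\<Lambda>\<close> with itself at \<open>x = g\<close> shows
    that \<open>\<Lambda>(g S(?g))\<close> is the square of \<open>\<Lambda>(S(g))\<close>, hence
    nonzero.\<close>
  moreover have "?g \<noteq> 0"
    using left_inv_swap[OF \<Lambda> \<Lambda>, of g g] nz lin_scale[OF antipode_linear, of 0 0]
      lin_scale[OF l, of 0 0] by auto
  ultimately have "\<nu> x = 0" for x using translate_inj[OF \<nu>] by blast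
  then show thesis by (intro that[of c]) (auto simp: \<nu>_def fun_eq_iff)
qed

section \<open>Rational forms\<close>

text \<open>The left ideal generated by \<open>u\<close> consists of the forms
  \<open>\<psi> \<circ> coact u\<close>, which are combinations of the finitely many
  \<open>v j\<close> with coefficients \<open>\<psi> (c j)\<close>. It contains \<open>u\<close>,
  obtained for \<open>\<psi> = counit\<close>.\<close>

lemma rational_partI:
  assumes u: "lin (*) u" and J: "finite J" "\<And>j. j \<in> J \<Longrightarrow> lin (*) (v j)"
    and coact: "\<And>x. coact u x = (\<Sum>j\<in>J. scale (v j x) (c j))"
  shows "u \<in> rational_part scale comult"
proof -
  interpret D: vector_space "dual_scale :: 'k \<Rightarrow> ('a \<Rightarrow> 'k) \<Rightarrow> _" by (rule vector_space_dual_scale)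
  define I where "I = (\<lambda>\<psi>. dual_mult comult \<psi> u) ` dual scale"
  have I_eq: "I = (\<lambda>\<psi> x. \<psi> (coact u x)) ` dual scale"
    unfolding I_def by (intro image_cong) (auto simp: dual_iff dual_mult_eq)
  have "D.subspace I"
  proof (rule D.subspaceI)
    have "lin (*) (0 :: 'a \<Rightarrow> 'k)" by (rule linI) (auto simp: vector_space_mult)
    then show "0 \<in> I" by (auto simp: I_eq dual_iff fun_eq_iff image_iff intro!: bexI[of _ 0])
  next
    fix \<phi>1 \<phi>2 assume "\<phi>1 \<in> I" "\<phi>2 \<in> I"
    then obtain \<psi>1 \<psi>2 where "lin (*) \<psi>1" "lin (*) \<psi>2" "\<phi>1 = (\<lambda>x. \<psi>1 (coact u x))"
      "\<phi>2 = (\<lambda>x. \<psi>2 (coact u x))" by (auto simp: I_eq dual_iff)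
    moreover from this have "lin (*) (\<psi>1 + \<psi>2)"
      by (intro linI) (auto simp: vector_space_mult lin_add lin_scale algebra_simps)
    ultimately show "\<phi>1 + \<phi>2 \<in> I"
      by (auto simp: I_eq dual_iff image_iff fun_eq_iff intro!: bexI[of _ "\<psi>1 + \<psi>2"])
  next
    fix k \<phi> assume "\<phi> \<in> I"
    then obtain \<psi> where "lin (*) \<psi>" "\<phi> = (\<lambda>x. \<psi> (coact u x))" by (auto simp: I_eq dual_iff)
    moreover from this have "lin (*) (dual_scale k \<psi>)"
      by (intro linI) (auto simp: vector_space_mult lin_add lin_scale algebra_simps dual_scale_def)
    ultimately show "dual_scale k \<phi> \<in> I"
      by (auto simp: I_eq dual_iff image_iff fun_eq_iff dual_scale_def intro!: bexI[of _ "dual_scale k \<psi>"])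
  qed
  moreover have "I \<subseteq> dual scale"
    using u by (auto simp: I_def dual_iff dual_mult_linear)
  moreover have "dual_mult comult \<phi> \<psi> \<in> I" if "\<phi> \<in> dual scale" "\<psi> \<in> I" for \<phi> \<psi>
    using that u by (auto simp: I_def dual_iff dual_mult_linear dual_mult_assoc[symmetric])
  ultimately have "dual_left_ideal scale comult I"
    by (simp add: dual_left_ideal_def)
  moreover obtain B where "finite B" "I = D.span B"
  proof -
    \<comment> \<open>The \<open>v j\<close> span a space containing \<open>I\<close> but need not
      lie in \<open>I\<close>, so a set whose span is exactly \<open>I\<close> is taken from inside
      \<open>I\<close>.\<close>
    obtain B where B: "B \<subseteq> I" "D.independent B" "I \<subseteq> D.span B"
      using D.maximal_independent_subset by blast
    have "I \<subseteq> D.span (v ` J)"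
    proof
      fix \<phi> assume "\<phi> \<in> I"
      then obtain \<psi> where \<psi>: "lin (*) \<psi>" "\<phi> = (\<lambda>x. \<psi> (coact u x))" by (auto simp: I_eq dual_iff)
      interpret \<psi>: Vector_Spaces.linear scale "(*)" \<psi> by (rule \<psi>(1))
      have "\<phi> = (\<Sum>j\<in>J. dual_scale (\<psi> (c j)) (v j))"
        by (simp add: \<psi>(2) coact \<psi>.sum \<psi>.scale dual_scale_def fun_eq_iff sum_apply_fun mult.commute)
      also have "\<dots> \<in> D.span (v ` J)"
        by (intro D.span_sum D.span_scale D.span_base) auto
      finally show "\<phi> \<in> D.span (v ` J)" .
    qed
    then have "finite B"
      using D.independent_span_bound[of "v ` J" B] B J(1) by auto
    moreover have "I = D.span B"
      using D.span_subspace[OF B(1,3) \<open>D.subspace I\<close>] by simp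
    ultimately show thesis by (rule that)
  qed
  moreover have "u \<in> I"
    unfolding I_eq using counit_linear by (auto simp: dual_iff counit_coact[OF u] intro!: image_eqI[of _ _ counit])
  ultimately show ?thesis
    unfolding rational_part_def by (intro D.span_base) auto
qed

lemma rational_part_subset: "rational_part scale comult \<subseteq> dual scale"
proof -
  interpret D: vector_space "dual_scale :: 'k \<Rightarrow> ('a \<Rightarrow> 'k) \<Rightarrow> _" by (rule vector_space_dual_scale)
  have "D.subspace (dual scale :: ('a \<Rightarrow> 'k) set)"
    by (intro D.subspaceI)
      (auto simp: dual_iff dual_scale_def lin_add lin_scale algebra_simps vector_space_mult intro!: linI)
  then show ?thesis
    unfolding rational_part_def by (intro D.span_minimal) (auto simp: dual_left_ideal_def)
qed

text \<open>This is the shape required by \<open>rational_partI\<close>, with the keys of the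
  representative of \<open>\<Delta> h\<close> as index set.\<close>

lemma sweedler_sum_coef:
  "sweedler scale comult (\<lambda>a b. scale (f a x) (g b)) h
    = (\<Sum>p\<in>Poly_Mapping.keys (tensor_rep (comult h)).
        scale (f (fst p) x) (scale (Poly_Mapping.lookup (tensor_rep (comult h)) p) (g (snd p))))"
  by (simp add: sweedler_def lin_ext_def split_def mult.commute)

lemma sweedler_sum_coef_right:
  "sweedler scale comult (\<lambda>a b. scale (f b x) (g a)) h
    = (\<Sum>p\<in>Poly_Mapping.keys (tensor_rep (comult h)).
        scale (f (snd p) x) (scale (Poly_Mapping.lookup (tensor_rep (comult h)) p) (g (fst p))))"
  by (simp add: sweedler_def lin_ext_def split_def mult.commute)

lemma translate_rational:
  assumes "left_inv \<Lambda>"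
  shows "translate \<Lambda> h \<in> rational_part scale comult"
proof -
  have l: "lin (*) \<Lambda>" using assms by (simp add: left_inv_def)
  have "coact (translate \<Lambda> h) x = (\<Sum>p\<in>Poly_Mapping.keys (tensor_rep (comult h)).
      scale (translate \<Lambda> (fst p) x)
        (scale (Poly_Mapping.lookup (tensor_rep (comult h)) p) (snd p)))" for x
    unfolding conv_eq_coact[OF assms, symmetric] conv_eq_translate
    by (rule sweedler_sum_coef)
  from rational_partI[OF _ _ _ this] show ?thesis by (simp add: translate_linear l)
qed

text \<open>By \<open>coact_translate_left\<close> and left invariance, \<open>coact\<close> gives
  \<open>S(h1)\<close> weighted by \<open>\<Lambda>(h2 x)\<close>. These forms are needed for their
  value \<open>\<Lambda> h\<close> at \<open>1\<close>.\<close>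

lemma left_translate_rational:
  assumes "left_inv \<Lambda>"
  shows "(\<lambda>z. \<Lambda> (h * z)) \<in> rational_part scale comult"
proof -
  have l: "lin (*) \<Lambda>" using assms by (simp add: left_inv_def)
  have lin: "lin (*) (\<lambda>z. \<Lambda> (h * z))" for h by (rule lin_compose[OF l]) (intro lin_intros)
  have "coact (\<lambda>z. \<Lambda> (h * z)) x = sweedler scale comult (\<lambda>a b. scale (\<Lambda> (b * x)) (antipode a)) h" for x
    using assms by (simp add: coact_translate_left l left_inv_def scale_mult_right)
  then have "coact (\<lambda>z. \<Lambda> (h * z)) x = (\<Sum>p\<in>Poly_Mapping.keys (tensor_rep (comult h)).
      scale (\<Lambda> (snd p * x))
        (scale (Poly_Mapping.lookup (tensor_rep (comult h)) p) (antipode (fst p))))" for x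
    by (simp only: sweedler_sum_coef_right[where f = "\<lambda>b x. \<Lambda> (b * x)"])
  from rational_partI[OF _ _ _ this] show ?thesis by (simp add: lin)
qed

section \<open>Matrix coefficients of finite-dimensional left ideals\<close>

lemma dual_points:
  fixes B :: "('a \<Rightarrow> 'k) set"
  assumes "finite B" "\<And>b. b \<in> B \<Longrightarrow> lin (*) b" "\<not> module.dependent dual_scale B"
  shows "\<exists>p. \<forall>b\<in>B. \<forall>b'\<in>B. b (p b') = (if b = b' then 1 else 0)"
  using assms
proof (induction B rule: finite_induct)
  case (insert \<phi> B)
  interpret D: vector_space "dual_scale :: 'k \<Rightarrow> ('a \<Rightarrow> 'k) \<Rightarrow> _" by (rule vector_space_dual_scale)
  have ind: "D.independent B" "\<phi> \<notin> D.span B"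
    using insert by (auto simp: D.independent_insert)
  then obtain p where p: "\<And>b b'. b \<in> B \<Longrightarrow> b' \<in> B \<Longrightarrow> b (p b') = (if b = b' then 1 else 0)"
    using insert by auto
  have L: "Vector_Spaces.linear scale (*) b" if "b \<in> insert \<phi> B" for b using insert that by auto
  have "(\<Sum>b\<in>B. dual_scale (\<phi> (p b)) b) \<in> D.span B"
    by (intro D.span_sum D.span_scale D.span_base)
  then have "\<phi> \<noteq> (\<Sum>b\<in>B. dual_scale (\<phi> (p b)) b)" using ind by auto
  then obtain y where y: "\<phi> y \<noteq> (\<Sum>b\<in>B. \<phi> (p b) * b y)"
    by (auto simp: fun_eq_iff sum_apply_fun dual_scale_def)
  \<comment> \<open>The correction makes every form in \<open>B\<close> vanish at \<open>z\<close>;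
    \<open>\<phi> z\<close> is nonzero because \<open>y\<close> separates \<open>\<phi>\<close> from
    the combination with coefficients \<open>\<phi> (p b)\<close>.\<close>
  define z where "z = y - (\<Sum>b\<in>B. scale (b y) (p b))"
  interpret P: Vector_Spaces.linear scale "(*)" \<phi> using L by simp
  have \<phi>z: "\<phi> z \<noteq> 0" using y by (simp add: z_def P.diff P.sum P.scale mult.commute)
  have bz: "b z = 0" if "b \<in> B" for b
  proof -
    interpret b: Vector_Spaces.linear scale "(*)" b using L that by simp
    show ?thesis
      using insert.hyps(1) that by (simp add: z_def b.diff b.sum b.scale p if_distrib cong: if_cong)
  qed
  \<comment> \<open>The point for \<open>\<phi>\<close> is \<open>z\<close>, normalised. Subtracting
    a multiple of \<open>z\<close> from \<open>p b\<close> makes \<open>\<phi>\<close> vanish there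
    without changing the values of the forms in \<open>B\<close>.\<close>
  define q where "q b = (if b = \<phi> then scale (1 / \<phi> z) z else p b - scale (\<phi> (p b) / \<phi> z) z)" for b
  have "b (q b') = (if b = b' then 1 else 0)" if "b \<in> insert \<phi> B" "b' \<in> insert \<phi> B" for b b'
  proof -
    interpret b: Vector_Spaces.linear scale "(*)" b using L that by simp
    have "b (q b') = (if b' = \<phi> then b z / \<phi> z else b (p b') - \<phi> (p b') / \<phi> z * b z)"
      by (simp add: q_def b.diff b.scale)
    then show ?thesis
      using that insert.hyps(2) by (auto simp: bz p \<phi>z)
  qed
  then show ?case by blast
qed auto

lemma separating_functional:
  assumes "\<And>\<psi>. lin (*) \<psi> \<Longrightarrow> \<psi> x = \<psi> y"
  shows "x = y"
proof (rule ccontr)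
  assume "x \<noteq> y"
  then have "independent {x - y}" by simp
  interpret K: vector_space "(*) :: 'k \<Rightarrow> 'k \<Rightarrow> 'k" by (rule vector_space_mult)
  interpret P: vector_space_pair scale "(*) :: 'k \<Rightarrow> 'k \<Rightarrow> 'k" by unfold_locales
  obtain \<psi> where "lin (*) \<psi>" "\<psi> (x - y) = 1"
    using P.linear_independent_extend[OF \<open>independent {x - y}\<close>, of "\<lambda>_. 1"] by auto
  moreover from this have "\<psi> (x - y) = \<psi> x - \<psi> y"
    using lin_add[of "(*)" \<psi> "x - y" y] by simp
  ultimately show False using assms[of \<psi>] by simp
qed

text \<open>Evaluation at points dual to \<open>B\<close> extracts the matrix of coefficients of the
  comodule spanned by \<open>B\<close>: \<open>c i j\<close> is \<open>coact j (p i)\<close>. Its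
  indices are the basis forms themselves.\<close>

lemma finite_left_ideal_coact:
  assumes "dual_left_ideal scale comult (module.span dual_scale B)" "finite B"
    "\<not> module.dependent dual_scale B"
  obtains c where "\<And>j x. j \<in> B \<Longrightarrow> coact j x = (\<Sum>i\<in>B. scale (i x) (c i j))"
    "\<And>i j. i \<in> B \<Longrightarrow> j \<in> B \<Longrightarrow> counit (c i j) = (if i = j then 1 else 0)"
    "\<And>F i j. (\<And>b. lin scale (\<lambda>a. F a b)) \<Longrightarrow> (\<And>a. lin scale (F a)) \<Longrightarrow> i \<in> B \<Longrightarrow> j \<in> B
      \<Longrightarrow> sweedler scale comult F (c i j) = (\<Sum>k\<in>B. F (c i k) (c k j))"
proof -
  interpret D: vector_space "dual_scale :: 'k \<Rightarrow> ('a \<Rightarrow> 'k) \<Rightarrow> _" by (rule vector_space_dual_scale)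
  have L: "lin (*) b" if "b \<in> B" for b
    using assms(1) D.span_base[OF that] by (auto simp: dual_left_ideal_def dual_iff)
  obtain p where p: "\<And>b b'. b \<in> B \<Longrightarrow> b' \<in> B \<Longrightarrow> b (p b') = (if b = b' then 1 else 0)"
    using dual_points[OF assms(2) L assms(3)] by blast
  define c where "c i j = coact j (p i)" for i j
  have coact: "coact j x = (\<Sum>i\<in>B. scale (i x) (c i j))" if j: "j \<in> B" for j x
  \<comment> \<open>A form \<open>\<psi>\<close> turns the claim into one about the product of
    \<open>\<psi>\<close> and \<open>j\<close>. This product lies in the left ideal spanned by
    \<open>B\<close>, and its coefficients are its values at the dual points.\<close>
  proof (rule separating_functional)
    fix \<psi> assume \<psi>: "lin (*) \<psi>"
    interpret \<psi>: Vector_Spaces.linear scale "(*)" \<psi> by (rule \<psi>)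
    have "dual_mult comult \<psi> j \<in> D.span B"
      using assms(1) \<psi> D.span_base[OF j] by (auto simp: dual_left_ideal_def dual_iff)
    then obtain a where "dual_mult comult \<psi> j = (\<Sum>i\<in>B. dual_scale (a i) i)"
      using D.span_finite[OF assms(2)] by auto
    then have a: "\<psi> (coact j y) = (\<Sum>i\<in>B. a i * i y)" for y
      by (simp add: dual_mult_eq[OF \<psi>, symmetric] sum_apply_fun dual_scale_def)
    have "\<psi> (c i j) = a i" if "i \<in> B" for i
    proof -
      have "\<psi> (c i j) = (\<Sum>k\<in>B. if k = i then a i else 0)"
        unfolding c_def a using that by (intro sum.cong) (auto simp: p)
      then show ?thesis using that assms(2) by simp
    qed
    then show "\<psi> (coact j x) = \<psi> (\<Sum>i\<in>B. scale (i x) (c i j))"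
      by (simp add: a \<psi>.sum \<psi>.scale mult.commute)
  qed
  moreover have "counit (c i j) = (if i = j then 1 else 0)" if "i \<in> B" "j \<in> B" for i j
    using that by (simp add: c_def counit_coact L p)
  moreover have "sweedler scale comult F (c i j) = (\<Sum>k\<in>B. F (c i k) (c k j))"
    if F1: "\<And>b. lin scale (\<lambda>a. F a b)" and F2: "\<And>a. lin scale (F a)" and "i \<in> B" "j \<in> B" for F i j
  proof -
    interpret F1: Vector_Spaces.linear scale scale "\<lambda>a. F a b" for b by (rule F1)
    interpret F2: Vector_Spaces.linear scale scale "F a" for a by (rule F2)
    have "sweedler scale comult F (c i j) = sweedler scale comult (\<lambda>a b. F a (coact j b)) (p i)"
      unfolding c_def by (rule sweedler_coact[OF F1 F2 L[OF \<open>j \<in> B\<close>]])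
    also have "\<dots> = (\<Sum>k\<in>B. sweedler scale comult (\<lambda>a b. F (scale (k b) a) (c k j)) (p i))"
      unfolding coact[OF \<open>j \<in> B\<close>] sweedler_def lin_ext_def split_def F2.sum F2.scale F1.scale
      by (simp only: scale_sum_right) (rule sum.swap)
    also have "\<dots> = (\<Sum>k\<in>B. F (c i k) (c k j))"
      unfolding c_def coact_def by (simp only: sweedler_linear_image[OF F1])
    finally show ?thesis .
  qed
  ultimately show thesis by (rule that)
qed

lemma translate_sum:
  assumes "lin (*) \<phi>"
  shows "translate \<phi> (\<Sum>j\<in>J. f j) x = (\<Sum>j\<in>J. translate \<phi> (f j) x)"
proof -
  interpret Vector_Spaces.linear scale "(*)" "\<lambda>y. translate \<phi> y x"
    by (rule translate_linear_arg[OF assms])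
  show ?thesis by (rule sum)
qed

text \<open>The form \<open>\<Lambda> k\<close> constructed here is the image of the basis element \<open>k\<close> under the projection
  \<open>m \<mapsto> m\<^sub>0 \<cdot> S(m\<^sub>1)\<close> of a Hopf module onto its coinvariants.\<close>

lemma finite_left_ideal_generated:
  assumes "dual_left_ideal scale comult (module.span dual_scale B)" "finite B"
    "\<not> module.dependent dual_scale B" and j: "j \<in> B"
  obtains \<Lambda> c where "\<And>k. k \<in> B \<Longrightarrow> left_inv (\<Lambda> k)" "j = (\<Sum>k\<in>B. translate (\<Lambda> k) (c k))"
proof -
  interpret D: vector_space "dual_scale :: 'k \<Rightarrow> ('a \<Rightarrow> 'k) \<Rightarrow> _" by (rule vector_space_dual_scale)
  have L: "lin (*) b" if "b \<in> B" for b
    using assms(1) D.span_base[OF that] by (auto simp: dual_left_ideal_def dual_iff)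
  obtain c where coact: "\<And>j x. j \<in> B \<Longrightarrow> coact j x = (\<Sum>i\<in>B. scale (i x) (c i j))"
    and counit: "\<And>i j. i \<in> B \<Longrightarrow> j \<in> B \<Longrightarrow> counit (c i j) = (if i = j then 1 else 0)"
    and comult: "\<And>F i j. (\<And>b. lin scale (\<lambda>a. F a b)) \<Longrightarrow> (\<And>a. lin scale (F a)) \<Longrightarrow> i \<in> B
      \<Longrightarrow> j \<in> B \<Longrightarrow> sweedler scale comult F (c i j) = (\<Sum>k\<in>B. F (c i k) (c k j))"
    by (fact finite_left_ideal_coact[OF assms(1-3)])
  let ?S = antipode
  define \<Lambda> where "\<Lambda> k x = (\<Sum>i\<in>B. i (x * ?S (?S (c i k))))" for k x
  have S_c: "(\<Sum>k\<in>B. ?S (c i k) * c k j) = (if i = j then 1 else 0)" if "i \<in> B" "j \<in> B" for i j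
    by (subst comult[of "\<lambda>a b. ?S a * b" i j, symmetric])
      (simp_all add: lin_intros antipode_left counit that)
  have c_S: "(\<Sum>k\<in>B. c i k * ?S (c k j)) = (if i = j then 1 else 0)" if "i \<in> B" "j \<in> B" for i j
    by (subst comult[of "\<lambda>a b. a * ?S b" i j, symmetric])
      (simp_all add: lin_intros antipode_right counit that)
  have "left_inv (\<Lambda> k)" if k: "k \<in> B" for k
  proof -
    have "lin (*) (\<Lambda> k)"
    proof (rule linI[OF vector_space_mult])
      fix x y a
      show "\<Lambda> k (x + y) = \<Lambda> k x + \<Lambda> k y"
        by (simp add: \<Lambda>_def distrib_right lin_add[OF L] sum.distrib)
      show "\<Lambda> k (scale a x) = a * \<Lambda> k x"
        by (simp add: \<Lambda>_def scale_mult_left lin_scale[OF L] sum_distrib_left)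
    qed
    moreover have "coact (\<Lambda> k) x = scale (\<Lambda> k x) 1" for x
    proof -
      have "coact (\<Lambda> k) x = (\<Sum>i\<in>B. coact (\<lambda>z. i (z * ?S (?S (c i k)))) x)"
        unfolding coact_def \<Lambda>_def sweedler_def lin_ext_def split_def scale_sum_left scale_sum_right
        by (rule sum.swap)
      also have "\<dots> = (\<Sum>i\<in>B. \<Sum>l\<in>B. coact i (x * ?S (?S (c l k))) * ?S (c i l))"
      proof (rule sum.cong[OF refl])
        fix i assume i: "i \<in> B"
        note lin = lin_intros lin_compose[OF coact_linear[OF L[OF i]]]
        \<comment> \<open>Since \<open>S\<close> reverses \<open>\<Delta>\<close>, the coproduct of
          \<open>S(c i k)\<close> is the sum over \<open>l\<close> of
          \<open>S(c l k) \<otimes> S(c i l)\<close>.\<close>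
        show "coact (\<lambda>z. i (z * ?S (?S (c i k)))) x
            = (\<Sum>l\<in>B. coact i (x * ?S (?S (c l k))) * ?S (c i l))"
          unfolding coact_translate[OF L[OF i]]
          by (subst sweedler_antipode, (intro lin)+, subst comult)
            ((intro lin)+, (rule i k refl)+)
      qed
      also have "\<dots> = (\<Sum>i\<in>B. \<Sum>l\<in>B. \<Sum>m\<in>B. scale (m (x * ?S (?S (c l k)))) (c m i * ?S (c i l)))"
        by (simp add: coact sum_distrib_right scale_mult_left)
      also have "\<dots> = (\<Sum>l\<in>B. \<Sum>m\<in>B. scale (m (x * ?S (?S (c l k)))) (\<Sum>i\<in>B. c m i * ?S (c i l)))"
        unfolding scale_sum_right by (rule trans[OF sum.swap sum.cong[OF refl sum.swap]])
      also have "\<dots> = (\<Sum>l\<in>B. \<Sum>m\<in>B. if m = l then scale (l (x * ?S (?S (c l k)))) 1 else 0)"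
        by (intro sum.cong refl) (simp add: c_S)
      also have "\<dots> = scale (\<Lambda> k x) 1"
        using assms(2) by (simp add: \<Lambda>_def scale_sum_left)
      finally show ?thesis .
    qed
    ultimately show ?thesis by (simp add: left_inv_def)
  qed
  \<comment> \<open>This is the Hopf module identity \<open>m = m0 S(m1) m2\<close>: successive
    translations by \<open>S(c i k)\<close> and \<open>c k j\<close> combine into one by their
    product, and the sum over \<open>k\<close> is an entry of the identity matrix.\<close>
  moreover have "j x = (\<Sum>k\<in>B. translate (\<Lambda> k) (c k j) x)" for x
  proof -
    have "(\<Sum>k\<in>B. translate (\<Lambda> k) (c k j) x)
        = (\<Sum>i\<in>B. \<Sum>k\<in>B. i (x * ?S (?S (c i k) * c k j)))"
      unfolding integral_functional_def \<Lambda>_def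
      by (subst sum.swap) (simp add: antipode_mult mult.assoc)
    also have "\<dots> = (\<Sum>i\<in>B. if i = j then j x else 0)"
    proof (rule sum.cong[OF refl])
      fix i assume i: "i \<in> B"
      have "(\<Sum>k\<in>B. i (x * ?S (?S (c i k) * c k j))) = i (x * ?S (\<Sum>k\<in>B. ?S (c i k) * c k j))"
        using translate_sum[OF L[OF i], of "\<lambda>k. ?S (c i k) * c k j" B x]
        by (simp add: integral_functional_def)
      then show "(\<Sum>k\<in>B. i (x * ?S (?S (c i k) * c k j))) = (if i = j then j x else 0)"
        using i j lin_scale[OF L[OF i], of 0 0] lin_scale[OF antipode_linear, of 0 0]
        by (simp add: S_c antipode_one)
    qed
    also have "\<dots> = j x" using j assms(2) by simp
    finally show ?thesis by simp
  qed
  then have "j = (\<Sum>k\<in>B. translate (\<Lambda> k) (c k j))"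
    by (simp add: fun_eq_iff sum_apply_fun)
  ultimately show thesis by (rule that)
qed

text \<open>Each finite-dimensional left ideal is given by a spanning set, which is replaced by a
  basis so that \<open>finite_left_ideal_generated\<close> applies.\<close>

lemma rational_part_generated:
  "rational_part scale comult
    \<subseteq> module.span dual_scale {translate \<Lambda> h | \<Lambda> h. left_inv \<Lambda>}" (is "_ \<subseteq> module.span _ ?T")
proof -
  interpret D: vector_space "dual_scale :: 'k \<Rightarrow> ('a \<Rightarrow> 'k) \<Rightarrow> _" by (rule vector_space_dual_scale)
  have "I \<subseteq> D.span ?T" if "dual_left_ideal scale comult I" "finite B0" "I = D.span B0" for I B0
  proof -
    obtain B where B: "B \<subseteq> I" "D.independent B" "I \<subseteq> D.span B"
      using D.maximal_independent_subset by blast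
    have I: "I = D.span B"
      using D.span_subspace[OF B(1,3)] that(1) by (simp add: dual_left_ideal_def)
    have fin: "finite B"
      using D.independent_span_bound[of B0 B] B that by auto
    have "j \<in> D.span ?T" if j: "j \<in> B" for j
    proof -
      obtain \<Lambda> c where \<Lambda>: "\<And>k. k \<in> B \<Longrightarrow> left_inv (\<Lambda> k)" and j: "j = (\<Sum>k\<in>B. translate (\<Lambda> k) (c k))"
        using finite_left_ideal_generated[OF _ fin B(2) j] \<open>dual_left_ideal scale comult I\<close> I
        by metis
      show ?thesis
        unfolding j by (intro D.span_sum D.span_base) (blast intro: \<Lambda>)
    qed
    then show ?thesis unfolding I by (intro D.span_minimal) auto
  qed
  then show ?thesis
    unfolding rational_part_def by (intro D.span_minimal) auto
qed

text \<open>This supplies the reference form for \<open>left_inv_unique_aux\<close>, which asks for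
  a nonzero value on the image of the antipode.\<close>

lemma left_inv_antipode_nonzero:
  assumes "left_inv \<Lambda>" "\<Lambda> h \<noteq> 0"
  shows "\<exists>\<mu> g. left_inv \<mu> \<and> \<mu> (antipode g) \<noteq> 0"
proof (rule ccontr)
  interpret D: vector_space "dual_scale :: 'k \<Rightarrow> ('a \<Rightarrow> 'k) \<Rightarrow> _" by (rule vector_space_dual_scale)
  assume "\<nexists>\<mu> g. left_inv \<mu> \<and> \<mu> (antipode g) \<noteq> 0"
  then have "{translate \<mu> g | \<mu> g. left_inv \<mu>} \<subseteq> {\<phi>. \<phi> 1 = 0}"
    by (auto simp: integral_functional_def)
  moreover have "D.subspace {\<phi> :: 'a \<Rightarrow> 'k. \<phi> 1 = 0}"
    by (rule D.subspaceI) (auto simp: dual_scale_def)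
  ultimately have "rational_part scale comult \<subseteq> {\<phi>. \<phi> 1 = 0}"
    using rational_part_generated D.span_minimal by blast
  then show False
    using left_translate_rational[OF assms(1), of h] assms(2) by auto
qed

lemma left_inv_unique:
  assumes \<Lambda>: "left_inv \<Lambda>" and "\<Lambda> h \<noteq> 0" and \<nu>: "left_inv \<nu>"
  obtains c where "\<nu> = (\<lambda>x. c * \<Lambda> x)"
proof -
  obtain \<mu> g where \<mu>: "left_inv \<mu>" "\<mu> (antipode g) \<noteq> 0"
    using left_inv_antipode_nonzero[OF assms(1,2)] by blast
  obtain c where c: "\<Lambda> = (\<lambda>x. c * \<mu> x)" using left_inv_unique_aux[OF \<mu>(1) \<Lambda> \<mu>(2)] .
  obtain d where "\<nu> = (\<lambda>x. d * \<mu> x)" using left_inv_unique_aux[OF \<mu>(1) \<nu> \<mu>(2)] .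
  then have "\<nu> = (\<lambda>x. d / c * \<Lambda> x)" using c assms(2) by auto
  then show thesis by (rule that)
qed

section \<open>Bijectivity and transport of the algebra structure\<close>

lemma translate_add: "lin (*) \<Lambda> \<Longrightarrow> translate \<Lambda> (g + h) = translate \<Lambda> g + translate \<Lambda> h"
  using lin_add[OF translate_linear_arg] by fastforce

lemma translate_scale: "lin (*) \<Lambda> \<Longrightarrow> translate \<Lambda> (scale c h) = dual_scale c (translate \<Lambda> h)"
  using lin_scale[OF translate_linear_arg] by (fastforce simp: dual_scale_def)

text \<open>By uniqueness every left invariant form is a multiple of \<open>\<Lambda>\<close> by
  some \<open>c\<close>. Its translate by \<open>g\<close> is the translate of
  \<open>\<Lambda>\<close> by \<open>scale c g\<close>, so the range contains all generators of the
  rational part.\<close>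

lemma range_translate:
  assumes \<Lambda>: "left_inv \<Lambda>" and nz: "\<Lambda> h \<noteq> 0"
  shows "range (translate \<Lambda>) = rational_part scale comult"
proof
  interpret D: vector_space "dual_scale :: 'k \<Rightarrow> ('a \<Rightarrow> 'k) \<Rightarrow> _" by (rule vector_space_dual_scale)
  have l: "lin (*) \<Lambda>" using \<Lambda> by (simp add: left_inv_def)
  show "range (translate \<Lambda>) \<subseteq> rational_part scale comult"
    using translate_rational[OF \<Lambda>] by auto
  have "D.subspace (range (translate \<Lambda>))"
  proof (rule D.subspaceI)
    show "0 \<in> range (translate \<Lambda>)"
      using translate_scale[OF l, of 0 0] by (intro image_eqI[of _ _ 0]) simp_all
  qed (auto simp: translate_add[OF l, symmetric] translate_scale[OF l, symmetric])
  moreover have "{translate \<mu> g | \<mu> g. left_inv \<mu>} \<subseteq> range (translate \<Lambda>)"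
  proof clarify
    fix \<mu> g assume "left_inv \<mu>"
    then obtain c where "\<mu> = (\<lambda>x. c * \<Lambda> x)" by (rule left_inv_unique[OF \<Lambda> nz])
    then have "translate \<mu> g = translate \<Lambda> (scale c g)"
      by (simp add: translate_scale[OF l]) (simp add: integral_functional_def dual_scale_def)
    then show "translate \<mu> g \<in> range (translate \<Lambda>)" by simp
  qed
  ultimately have "D.span {translate \<mu> g | \<mu> g. left_inv \<mu>} \<subseteq> range (translate \<Lambda>)"
    by (intro D.span_minimal)
  then show "rational_part scale comult \<subseteq> range (translate \<Lambda>)"
    using rational_part_generated by blast
qed

lemma inj_translate:
  assumes \<Lambda>: "left_inv \<Lambda>" and nz: "\<Lambda> x \<noteq> 0"
  shows "inj (translate \<Lambda>)"
proof (rule injI)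
  fix g h assume eq: "translate \<Lambda> g = translate \<Lambda> h"
  have l: "lin (*) \<Lambda>" using \<Lambda> by (simp add: left_inv_def)
  have "translate \<Lambda> (g - h) z = 0" for z
    using translate_add[OF l, of "g - h" h] eq by simp
  then have "g - h = 0" by (rule translate_inj[OF \<Lambda> nz])
  then show "g = h" by simp
qed

lemma translate_algebra_iso:
  assumes "left_integral scale comult \<Lambda>"
  shows "nonunital_algebra_iso scale UNIV (conv \<Lambda>)
    dual_scale (rational_part scale comult) (dual_mult comult) (translate \<Lambda>)"
proof -
  interpret D: vector_space "dual_scale :: 'k \<Rightarrow> ('a \<Rightarrow> 'k) \<Rightarrow> _" by (rule vector_space_dual_scale)
  obtain x0 where \<Lambda>: "left_inv \<Lambda>" and nz: "\<Lambda> x0 \<noteq> 0"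
    using assms by (auto simp: left_integral_iff)
  have l: "lin (*) \<Lambda>" using \<Lambda> by (simp add: left_inv_def)
  note inj = inj_translate[OF \<Lambda> nz] and range = range_translate[OF \<Lambda> nz]
  note hom = translate_conv[OF \<Lambda>] and add = translate_add[OF l] and sc = translate_scale[OF l]
  have R: "lin (*) \<phi>" if "\<phi> \<in> rational_part scale comult" for \<phi>
    using that rational_part_subset by (auto simp: dual_iff)
  have dm_add: "dual_mult comult (\<phi> + \<psi>) \<chi> = dual_mult comult \<phi> \<chi> + dual_mult comult \<psi> \<chi>"
    "dual_mult comult \<phi> (\<psi> + \<chi>) = dual_mult comult \<phi> \<psi> + dual_mult comult \<phi> \<chi>" for \<phi> \<psi> \<chi>
    by (auto simp: dual_mult_def sweedler_def lin_ext_def split_def algebra_simps sum.distrib fun_eq_iff)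
  have dm_scale: "dual_mult comult (dual_scale c \<phi>) \<psi> = dual_scale c (dual_mult comult \<phi> \<psi>)"
    "dual_mult comult \<phi> (dual_scale c \<psi>) = dual_scale c (dual_mult comult \<phi> \<psi>)" for c \<phi> \<psi>
    by (auto simp: dual_mult_def dual_scale_def sweedler_def lin_ext_def split_def sum_distrib_left
        mult.assoc mult.left_commute fun_eq_iff)
  have inj_eq: "g = h" if "translate \<Lambda> g = translate \<Lambda> h" for g h
    using inj that by (auto dest: injD)
  have "nonunital_algebra dual_scale (rational_part scale comult) (dual_mult comult)"
    unfolding nonunital_algebra_def
  proof (intro conjI ballI allI)
    show "D.subspace (rational_part scale comult)" by (simp add: rational_part_def)
    show "dual_mult comult \<phi> \<psi> \<in> rational_part scale comult"
      if "\<phi> \<in> rational_part scale comult" "\<psi> \<in> rational_part scale comult" for \<phi> \<psi>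
      using that unfolding range[symmetric] by (auto simp: hom[symmetric])
  qed (auto simp: D.vector_space_axioms dm_add dm_scale dual_mult_assoc R)
  \<comment> \<open>The laws for \<open>conv \<Lambda>\<close> are pulled back from those for
    \<open>dual_mult\<close> along the injective map \<open>translate \<Lambda>\<close>.\<close>
  moreover have "nonunital_algebra scale UNIV (conv \<Lambda>)"
    unfolding nonunital_algebra_def
    by (auto simp: vector_space_axioms hom add sc dm_add dm_scale dual_mult_assoc translate_linear l
        intro!: inj_eq)
  ultimately show ?thesis
    unfolding nonunital_algebra_iso_def
    using inj range by (auto simp: bij_betw_def add sc hom)
qed

end

theorem proposition2p5:
  fixes scale :: "'k::{alg_closed_field, field_char_0} \<Rightarrow> 'a::ring_1 \<Rightarrow> 'a"
    and \<Delta> :: "'a \<Rightarrow> (('a \<times> 'a) \<Rightarrow>\<^sub>0 'k) set"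
    and \<epsilon> :: "'a \<Rightarrow> 'k"
    and S :: "'a \<Rightarrow> 'a"
    and \<Lambda> :: "'a \<Rightarrow> 'k"
  assumes "hopf_algebra scale \<Delta> \<epsilon> S"
    and "left_integral scale \<Delta> \<Lambda>"
  shows "rational_part scale \<Delta> \<subseteq> dual scale
       \<and> nonunital_algebra_iso
           scale UNIV (integral_conv scale \<Delta> S \<Lambda>)
           dual_scale (rational_part scale \<Delta>) (dual_mult \<Delta>)
           (integral_functional S \<Lambda>)"
proof -
  interpret hopf_algebra scale \<Delta> \<epsilon> S by fact
  show ?thesis
    using rational_part_subset translate_algebra_iso[OF assms(2)] by blast
qed

end
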